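(* Let $n\ge3$ be an odd integer. Then for every integer $m\ge1$, $$\begin{aligned}\lim_{s\to-n+\frac12}\left(s+n-\tfrac12\right)I_m(s)&=-\frac{\Gamma(m+n-1)\,\Gamma(m-\frac12)\,\Gamma(\frac n2)^2\,\Gamma(n-\frac12)^2}{\Gamma(\frac12)\,\Gamma(m)^2\,\Gamma(\frac{n-1}{2})\,\Gamma(n)\,\Gamma(n-1)^2\,\Gamma(\frac{n+1}{2})}\\&\quad\times{}_4F_3\!\left(\begin{matrix}\frac12,\ \frac n2,\ n-\frac12,\ 1-m\\ \frac{n+1}{2},\ n,\ \frac32-m\end{matrix};1\right)\end{aligned}$$ and $$\begin{aligned}\lim_{s\to-n-\frac12}\left(s+n+\tfrac12\right)I_m(s)&=-\frac{\Gamma(\frac32)\,\Gamma(m+n-1)\,\Gamma(\frac n2)\,\Gamma(n-\frac32)\,\Gamma(n+\frac12)\,\Gamma(m+\frac n2+\frac12)\,\Gamma(m-\frac32)}{\Gamma(n-1)^2\,\Gamma(m)^2\,\Gamma(m+\frac n2-\frac32)\,\Gamma(\frac{n+1}{2})\,\Gamma(\frac{n+3}{2})\,\Gamma(1-\frac n2)\,\Gamma(n)}\\&\quad\times{}_4F_3\!\left(\begin{matrix}\frac32,\ \frac n2,\ n+\frac12,\ 1-m\\ \frac{n+3}{2},\ \frac52-m,\ n\end{matrix};1\right).\end{aligned}$$ In particular, $-n-\frac12\in\mathcal{W}_1^d$ and $-n+\frac12\in\mathcal{W}_1^d$.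
   Context: $(a)_\ell=a(a+1)\cdots(a+\ell-1)$ is the Pochhammer symbol, $(a)_0=1$. The generalized hypergeometric series is $${}_pF_q\!\left(\begin{matrix}a_1,\dots,a_p\\ b_1,\dots,b_q\end{matrix};z\right)=\sum_{\ell\ge0}\frac{(a_1)_\ell\cdots(a_p)_\ell}{(b_1)_\ell\cdots(b_q)_\ell}\frac{z^\ell}{\ell!}.$$ For integers $n>2$ and $m\ge0$ put $$S_m(t)=\frac{(n-1)_m}{(\frac n2)_m}\,{}_2F_1\!\left(\begin{matrix}m,\ 1-\frac n2\\ m+\frac n2\end{matrix};t\right),$$ and for $s>-1$ $$I_m(s)=\frac{\Gamma(\frac n2+s+1)}{\Gamma(\frac n2)\,\Gamma(s+1)}\int_0^1t^{m+\frac n2-1}(1-t)^sS_m(t)^2\,dt.$$ The function $I_m$ extends to a meromorphic function on $\mathbb{C}$, still denoted $I_m(s)$ (and $I_0\equiv1$). For $s_0\in\mathbb{C}$ and an integer $r\ge1$, let $c_{-r,m}(s_0)$ be the $(-r)$-th coefficient in the Laurent expansion of $I_m(s)$ at $s=s_0$, that is, the coefficient of $(s-s_0)^{-r}$. The discrete Wallach set $\mathcal{W}_r^d$ (depending on $n$) is the set of $s_0\in\mathbb{C}$ such that $I_m(s)$ has a pole at $s_0$ for some $m$, and the numbers $c_{-r,m}(s_0)$, $m\ge0$, are either all nonnegative or all nonpositive.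
   Formalization: The right-hand side of the second limit formula is multiplied by $(-1)^{(n-3)/2}$: as printed its sign is wrong for $n\equiv1\pmod 4$ (e.g. $n=5$, $m=1$, where the limit is negative but the printed value is positive); for $n\equiv3\pmod 4$ it is unchanged. *)

theory Defs
  imports "HOL-Complex_Analysis.Complex_Analysis"
begin

definition hypergeo :: "'a list \<Rightarrow> 'a list \<Rightarrow> 'a \<Rightarrow> 'a :: {banach, real_normed_field}" where
  "hypergeo as bs z = eval_fps (fps_hypergeo as bs 1) z"

definition S_fun :: "nat \<Rightarrow> nat \<Rightarrow> real \<Rightarrow> real" where
  "S_fun n m t = pochhammer (real n - 1) m / pochhammer (real n / 2) m *
     hypergeo [real m, 1 - real n / 2] [real m + real n / 2] t"

definition I_integral :: "nat \<Rightarrow> nat \<Rightarrow> real \<Rightarrow> real" where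
  "I_integral n m s = Gamma (real n / 2 + s + 1) / (Gamma (real n / 2) * Gamma (s + 1)) *
     (LINT t:{0<..<1}|lborel.
        t powr (real m + real n / 2 - 1) * (1 - t) powr s * (S_fun n m t)\<^sup>2)"

text \<open>
  The meromorphic continuation of \<^term>\<open>I_integral n m\<close>. By the identity theorem there is at most
  one nicely meromorphic function with this property (``nicely'' fixes the value 0 at the poles), so
  the choice is unique. That one exists is not assumed anywhere; it is part of what has to be proved
  when reasoning about \<open>I_mero\<close>.
\<close>
definition I_mero :: "nat \<Rightarrow> nat \<Rightarrow> complex \<Rightarrow> complex" where
  "I_mero n m = (SOME f. f nicely_meromorphic_on UNIV \<and>
     (\<forall>s::real. s > -1 \<longrightarrow> f (of_real s) = of_real (I_integral n m s)))"

definition I_coeff :: "nat \<Rightarrow> nat \<Rightarrow> nat \<Rightarrow> complex \<Rightarrow> complex" where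
  "I_coeff n r m s0 = fls_nth (laurent_expansion (I_mero n m) s0) (- int r)"

definition discrete_Wallach_set :: "nat \<Rightarrow> nat \<Rightarrow> complex set" where
  "discrete_Wallach_set n r = {s0. (\<exists>m. is_pole (I_mero n m) s0) \<and>
     ((\<forall>m. I_coeff n r m s0 \<in> \<real>\<^sub>\<ge>\<^sub>0) \<or> (\<forall>m. I_coeff n r m s0 \<in> \<real>\<^sub>\<le>\<^sub>0))}"

text \<open>
  Pitfall: in the residue of \<open>I_mero n m\<close> at \<open>- n - 1/2\<close>, the printed formula contains
  \<open>1 / Gamma (1 - n/2)\<close>, whose sign alternates with the residue class of the odd number \<open>n\<close>
  modulo 4, whereas the residue itself is always negative. The formula as printed has the wrong sign
  for \<open>n\<close> congruent to 1 modulo 4 (it is correct for \<open>n\<close> congruent to 3); the factor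
  \<open>(-1) ^ ((n - 3) div 2)\<close> is the correction.
\<close>

end

theory Submission
  imports Defs "HOL-Real_Asymp.Real_Asymp"
begin

text \<open>
  Write \<open>\<nu> = n/2\<close> and \<open>\<sigma> = s + n\<close>. The contiguous relations of \<open>S\<^sub>m\<close> make a quadratic expression in
  \<open>S\<^sub>m\<close> and \<open>S\<^sub>m\<^sub>-\<^sub>1\<close> a primitive of the integrand of a three-term recurrence in \<open>m\<close>,
  \<open>m\<^sup>2(m-1+\<nu>+\<sigma>) I\<^sub>m\<^sub>+\<^sub>1 - 2(m-1+\<nu>)(m\<^sup>2+(n-2)m+1-\<nu>+\<sigma>(1-\<sigma>)/2) I\<^sub>m + (m+n-2)\<^sup>2(m-1+\<nu>-\<sigma>) I\<^sub>m\<^sub>-\<^sub>1 = 0\<close>,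
  so the meromorphic continuation of all \<open>I\<^sub>m\<close> reduces to that of \<open>I\<^sub>1\<close>. For \<open>m = 1\<close> the
  hypergeometric function solves a first-order equation, and partial integration gives an
  inhomogeneous recurrence in \<open>s\<close>: \<open>I\<^sub>1\<close> is a rational function times \<open>\<Sum>i. R (\<sigma> + i)\<close> for an even
  rational function \<open>R\<close> (this is where \<open>n\<close> odd enters), whose partial fractions reduce the sum to
  a trigamma function plus a rational function. At \<open>\<sigma> = \<plusminus>1/2\<close> the simple fractions cancel in pairs and
  only the double pole of \<open>R\<close> at 0 contributes. Finally the residues, starting from \<open>I\<^sub>0 = 1\<close> with
  residue 0, satisfy the recurrence in \<open>m\<close>, which the coefficients of
  \<open>(1-x)\<^sup>-\<^sup>\<sigma> \<^sub>3F\<^sub>2(1-\<sigma>, \<nu>, n-\<sigma>; \<nu>+1-\<sigma>, n; x)\<close> satisfy as well; these convolutions are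
  the terminating \<open>\<^sub>4F\<^sub>3\<close> sums.
\<close>

section \<open>Contiguous relations\<close>

text \<open>Power series of S_m with n = 2v, for real v. The prefactor is included because it
  absorbs the factors that a shift of m would otherwise put into the contiguous relations.\<close>

definition S_fps :: "real \<Rightarrow> nat \<Rightarrow> real fps" where
  "S_fps v m = Abs_fps (\<lambda>k. pochhammer (2 * v - 1) m / pochhammer v m *
     (pochhammer (real m) k * pochhammer (1 - v) k / (pochhammer (real m + v) k * fact k)))"

lemma S_fps_nth_Suc:
  assumes "v > 0"
  shows "fps_nth (S_fps v m) (Suc k) =
    fps_nth (S_fps v m) k * ((real m + k) * (1 - v + k) / ((real m + v + k) * (k + 1)))"
  by (simp add: S_fps_def pochhammer_Suc divide_simps)

text \<open>Coefficient of t^k in (1 - t) S_m' = m (S_m - S_(m+1)). The parameter shift (m)_k to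
  (m+1)_k is kept multiplied out, since m may be 0.\<close>

lemma S_fps_raise_nth:
  assumes "v > 0"
  shows "(real k + 1) * fps_nth (S_fps v m) (Suc k) - (real m + k) * fps_nth (S_fps v m) k =
    - (real m * fps_nth (S_fps v (Suc m)) k)"
proof -
  have pos: "real m + v + k > 0" "pochhammer v m > 0" "pochhammer (real m + v) k > 0"
    using assms by (auto intro!: pochhammer_pos add_nonneg_pos)
  have 1: "real m * pochhammer (real m + 1) k = pochhammer (real m) k * (real m + k)"
    using pochhammer_rec[of "real m" k] pochhammer_Suc[of "real m" k] by simp
  have "(real m + v) * pochhammer (real m + v + 1) k = pochhammer (real m + v) k * (real m + v + k)"
    using pochhammer_rec[of "real m + v" k] pochhammer_Suc[of "real m + v" k] by simp
  hence 2: "pochhammer (real m + v + 1) k = pochhammer (real m + v) k * (real m + v + k) / (real m + v)"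
    using assms by (simp add: field_simps add_pos_nonneg)
  have mv: "real m + v > 0" using assms by auto
  have "real m * fps_nth (S_fps v (Suc m)) k =
     pochhammer (2 * v - 1) m * (2 * v - 1 + m) / (pochhammer v m * (v + m)) *
     ((real m * pochhammer (real m + 1) k) * pochhammer (1 - v) k
       / (pochhammer (real m + v + 1) k * fact k))"
    by (simp add: S_fps_def pochhammer_Suc algebra_simps)
  also have "\<dots> = fps_nth (S_fps v m) k * (real m + k) * (2 * v - 1 + m) / (real m + v + k)"
  proof -
    have "c * q / (w * (v + m)) * ((M * mk) * b / ((p * r / (m + v)) * f)) = c / w * (M * b / (p * f)) * mk * q / r"
      if "w > 0" "p > 0" "r > 0" "f > 0" for c q w M mk b p r f :: real
      using that mv by (simp add: divide_simps)
    thus ?thesis unfolding 1 2 using pos by (simp add: S_fps_def)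
  qed
  finally have A: "real m * fps_nth (S_fps v (Suc m)) k =
     fps_nth (S_fps v m) k * (real m + k) * (2 * v - 1 + m) / (real m + v + k)" .
  show ?thesis
    unfolding A S_fps_nth_Suc[OF assms] using pos(1)
    by (simp add: divide_simps) (simp add: algebra_simps)
qed

text \<open>Coefficient of t^(k+1) in t (1 - t) S_(m+1)' = (m + 2v - 1) S_m - (m + v + (v - 1) t)
  S_(m+1). The constant coefficient is treated where the series are assembled.\<close>

lemma S_fps_lower_nth:
  assumes "v > 1 / 2"
  shows "(real (Suc k) + m + v) * fps_nth (S_fps v (Suc m)) (Suc k)
      + (v - 1 - k) * fps_nth (S_fps v (Suc m)) k =
    (real m + 2 * v - 1) * fps_nth (S_fps v m) (Suc k)"
proof -
  have pos: "real m + v + k > 0" "real m + v > 0" "pochhammer v m > 0" "pochhammer (real m + v) k > 0"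
    "pochhammer (2 * v - 1) m > 0"
    using assms by (auto intro!: pochhammer_pos add_nonneg_pos)
  have "(real m + v) * pochhammer (real m + v + 1) k = pochhammer (real m + v) k * (real m + v + k)"
    using pochhammer_rec[of "real m + v" k] pochhammer_Suc[of "real m + v" k] by simp
  hence 2: "pochhammer (real m + v + 1) k = pochhammer (real m + v) k * (real m + v + k) / (real m + v)"
    using pos by (simp add: field_simps)
  have 3: "pochhammer (real m) (Suc k) = real m * pochhammer (real m + 1) k"
    by (rule pochhammer_rec)
  have e: "real (Suc m) = real m + 1" "real m + 1 + v = real m + v + 1" by auto
  have A: "fps_nth (S_fps v m) (Suc k) = fps_nth (S_fps v (Suc m)) k *
     (real m * (1 - v + k) / ((2 * v - 1 + m) * (k + 1)))"
  proof -
    have "c / w * (M * M1 * (b * B) / ((p * r) * (K * f))) =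
          c * q / (w * s) * (M1 * b / ((p * r / s) * f)) * (M * B / (q * K))"
      if "w > 0" "p > 0" "r > 0" "f > 0" "s > 0" "q > 0" "K > 0" for c q w M M1 b B p r K s f :: real
      using that by (simp add: divide_simps)
    from this[of "pochhammer v m" "pochhammer (real m + v) k" "real m + v + k" "fact k" "real m + v" "2 * v - 1 + m" "real k + 1"]
    show ?thesis unfolding S_fps_def fps_nth_Abs_fps 3 e 2 using pos assms
      by (simp add: pochhammer_Suc add_ac)
  qed
  show ?thesis
  proof -
    let ?f = "fps_nth (S_fps v (Suc m)) k"
    have 1: "(real (Suc k) + m + v) * fps_nth (S_fps v (Suc m)) (Suc k) =
        ?f * ((real m + 1 + k) * (1 - v + k) / (k + 1))"
      using S_fps_nth_Suc[of v "Suc m" k] pos assms by (simp add: add_ac)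
    have 2: "(real m + 2 * v - 1) * fps_nth (S_fps v m) (Suc k) =
        ?f * (real m * (1 - v + k) / (k + 1))"
    proof -
      have "real m + 2 * v - 1 > 0" using assms by simp
      thus ?thesis unfolding A by (simp add: divide_simps)
    qed
    have 3: "(real m + 1 + k) * (1 - v + k) / (k + 1) + (v - 1 - k) = real m * (1 - v + k) / (k + 1)"
      by (simp add: divide_simps) (simp add: algebra_simps)
    show ?thesis
      using distrib_left[of ?f "(real m + 1 + k) * (1 - v + k) / (k + 1)" "v - 1 - k"]
      unfolding 1 2 3 by (simp only: mult.commute)
  qed
qed

section \<open>Convergence up to the endpoint t = 1\<close>

text \<open>Raabe's test: consecutive coefficients have ratio 1 + 2v/k to first order, and 2v > 1.
  For m > 0 no coefficient vanishes, because \<open>v\<close> is not an integer; S_0 is constant and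
  treated apart.\<close>

lemma summable_S_fps:
  assumes "v > 1 / 2" "v \<notin> \<int>"
  shows "summable (\<lambda>k. \<bar>fps_nth (S_fps v m) k\<bar>)"
proof (cases "m = 0")
  case True
  have "fps_nth (S_fps v m) k = 0" if "k \<notin> {0}" for k
    using that True by (simp add: S_fps_def pochhammer_0_left)
  thus ?thesis
    by (intro summable_finite[of "{0}"]) auto
next
  case False
  define f where "f = (\<lambda>k. \<bar>fps_nth (S_fps v m) k\<bar>)"
  have nz: "1 - v + k \<noteq> 0" for k :: nat
  proof
    assume "1 - v + k = 0"
    hence "v = of_nat (k + 1)" by simp
    thus False using assms(2) by (metis Ints_of_nat)
  qed
  have nz2: "pochhammer (1 - v) k \<noteq> 0" for k
    using nz by (metis add.commute add_0 add_eq_0_iff pochhammer_eq_0_iff)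
  have pos: "f k > 0" for k
  proof -
    have "pochhammer v m > 0" "pochhammer (real m + v) k > 0" "pochhammer (2 * v - 1) m > 0"
         "pochhammer (real m) k > 0"
      using assms False by (auto intro!: pochhammer_pos add_nonneg_pos)
    thus ?thesis using nz2 by (simp add: f_def S_fps_def)
  qed
  have "(\<lambda>k. real k * (f k / f (Suc k) - 1)) \<longlonglongrightarrow> 2 * v"
  proof (rule Lim_transform_eventually)
    show "(\<lambda>k. real k * ((real m + v + k) * (k + 1) / ((real m + k) * (1 - v + k)) - 1)) \<longlonglongrightarrow> 2 * v"
      using assms by real_asymp
    show "\<forall>\<^sub>F k in sequentially. real k * ((real m + v + k) * (k + 1) / ((real m + k) * (1 - v + k)) - 1)
        = real k * (f k / f (Suc k) - 1)"
      using eventually_gt_at_top[of "nat \<lceil>v\<rceil>"]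
    proof eventually_elim
      case (elim k)
      hence "1 - v + k > 0" by linarith
      have "f (Suc k) = f k * ((real m + k) * (1 - v + k) / ((real m + v + k) * (k + 1)))"
        unfolding f_def using S_fps_nth_Suc[of v m k] assms \<open>1 - v + k > 0\<close> by (simp add: abs_mult)
      thus ?case using pos[of k] pos[of "Suc k"] by simp
    qed
  qed
  hence "(\<lambda>k. ereal (real k * (f k / f (Suc k) - 1))) \<longlonglongrightarrow> ereal (2 * v)"
    by simp
  hence "liminf (\<lambda>k. ereal (real k * (f k / f (Suc k) - 1))) = ereal (2 * v)"
    by (intro lim_imp_Liminf) auto
  hence "summable f"
    using assms pos by (intro raabes_test_convergence) auto
  thus ?thesis by (simp add: f_def)
qed

lemma fps_conv_radius_S_fps:
  assumes "v > 1 / 2" "v \<notin> \<int>"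
  shows "fps_conv_radius (S_fps v m) \<ge> 1"
proof -
  have "summable (\<lambda>k. fps_nth (S_fps v m) k * 1 ^ k)"
    using summable_rabs_cancel[OF summable_S_fps[OF assms, of m]] by simp
  from conv_radius_geI[OF this] show ?thesis by (simp add: fps_conv_radius_def one_ereal_def)
qed

lemma S_fun_eq_eval_fps:
  fixes n m :: nat
  defines "v \<equiv> real n / 2"
  assumes "v > 1 / 2" "v \<notin> \<int>" "t \<in> {0..1}"
  shows "S_fun n m t = eval_fps (S_fps v m) t"
proof -
  define c where "c = pochhammer (2 * v - 1) m / pochhammer v m"
  define g where "g = fps_nth (fps_hypergeo [real m, 1 - v] [real m + v] 1)"
  have eq: "fps_nth (S_fps v m) k = c * g k" for k
    by (simp add: S_fps_def c_def g_def)
  have "pochhammer (2 * v - 1) m > 0" "pochhammer v m > 0"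
    using assms(2) by (auto intro!: pochhammer_pos)
  hence "c \<noteq> 0"
    by (simp add: c_def)
  have "summable (\<lambda>k. \<bar>fps_nth (S_fps v m) k\<bar>)"
    by (rule summable_S_fps) fact+
  hence "summable (\<lambda>k. fps_nth (S_fps v m) k * t ^ k)"
  proof (rule summable_comparison_test')
    show "norm (fps_nth (S_fps v m) k * t ^ k) \<le> \<bar>fps_nth (S_fps v m) k\<bar>" if "k \<ge> 0" for k
      using assms(4) by (simp add: abs_mult power_le_one mult_left_le)
  qed
  hence "summable (\<lambda>k. c * (g k * t ^ k))"
    by (simp only: eq mult.assoc)
  hence "summable (\<lambda>k. g k * t ^ k)"
    using \<open>c \<noteq> 0\<close> by simp
  from suminf_mult[OF this, of c] have "eval_fps (S_fps v m) t = c * (\<Sum>k. g k * t ^ k)"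
    by (simp only: eval_fps_def eq mult.assoc)
  thus ?thesis
    by (simp only: S_fun_def hypergeo_def eval_fps_def c_def g_def v_def) simp
qed

text \<open>On [0,1] the terms are dominated by the absolute coefficients, so the M-test reaches t =
  1, where the radius of convergence alone says nothing.\<close>

lemma continuous_on_eval_fps_abs_summable:
  fixes F :: "real fps"
  assumes "summable (\<lambda>k. \<bar>fps_nth F k\<bar>)"
  shows "continuous_on {0..1} (eval_fps F)"
proof -
  have "uniform_limit {0..1} (\<lambda>n x. \<Sum>k<n. fps_nth F k * x ^ k) (\<lambda>x. \<Sum>k. fps_nth F k * x ^ k) sequentially"
    by (rule Weierstrass_m_test[OF _ assms]) (auto simp: abs_mult power_le_one mult_left_le)
  hence "continuous_on {0..1} (\<lambda>x. \<Sum>k. fps_nth F k * x ^ k)"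
    by (rule uniform_limit_theorem[rotated]) (auto intro!: always_eventually continuous_intros)
  thus ?thesis by (simp add: eval_fps_def[abs_def])
qed

definition S_ser :: "real \<Rightarrow> nat \<Rightarrow> real \<Rightarrow> real" where
  "S_ser v m t = eval_fps (S_fps v m) t"

lemma continuous_on_S_ser:
  assumes "v > 1 / 2" "v \<notin> \<int>"
  shows "continuous_on {0..1} (S_ser v m)"
  using continuous_on_eval_fps_abs_summable[OF summable_S_fps[OF assms]]
  unfolding S_ser_def[abs_def] .

lemma S_ser_0 [simp]: "S_ser v 0 t = 1"
proof -
  have "S_fps v 0 = 1"
    by (rule fps_ext) (simp add: S_fps_def pochhammer_0_left)
  thus ?thesis by (simp add: S_ser_def)
qed

text \<open>Evaluation turns the coefficient identities into differential relations inside the disc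
  of convergence. One expresses a derivative through the next function, the other through the
  previous one; eliminating the derivative links three consecutive functions.\<close>

lemma
  assumes "v > 1 / 2" "v \<notin> \<int>" "\<bar>t\<bar> < 1"
  shows S_ser_has_derivative: "(S_ser v m has_field_derivative eval_fps (fps_deriv (S_fps v m)) t) (at t)"
    and S_ser_raise: "(1 - t) * eval_fps (fps_deriv (S_fps v m)) t =
           real m * (S_ser v m t - S_ser v (Suc m) t)"
    and S_ser_lower: "t * (1 - t) * eval_fps (fps_deriv (S_fps v (Suc m))) t =
           (m + 2 * v - 1) * S_ser v m t - (m + v + (v - 1) * t) * S_ser v (Suc m) t"
proof -
  have R: "ereal (norm t) < fps_conv_radius (S_fps v k)" for k
    using assms fps_conv_radius_S_fps[of v k]
    by (metis ereal_less(3) less_le_trans real_norm_def)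
  have R': "ereal (norm t) < fps_conv_radius (fps_deriv (S_fps v k))" for k
    using R[of k] fps_conv_radius_deriv[of "S_fps v k"] by (metis less_le_trans)
  have RX: "ereal (norm t) < fps_conv_radius (fps_X * F)" if "ereal (norm t) < fps_conv_radius F" for F :: "real fps"
    using that fps_conv_radius_mult[of fps_X F] by (simp add: min_def less_le_trans)
  have RC: "ereal (norm t) < fps_conv_radius (fps_const c * F)" if "ereal (norm t) < fps_conv_radius F" for F :: "real fps" and c
    using that fps_conv_radius_mult[of "fps_const c" F] by (simp add: min_def less_le_trans)
  have RA: "ereal (norm t) < fps_conv_radius (F + G)" if "ereal (norm t) < fps_conv_radius F" "ereal (norm t) < fps_conv_radius G" for F G :: "real fps"
    using that fps_conv_radius_add[of F G] by (metis less_le_trans min_less_iff_conj)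
  have RD: "ereal (norm t) < fps_conv_radius (F - G)" if "ereal (norm t) < fps_conv_radius F" "ereal (norm t) < fps_conv_radius G" for F G :: "real fps"
    using that fps_conv_radius_diff[of F G] by (metis less_le_trans min_less_iff_conj)
  note conv = R R' RX RC RA RD
  have EX: "eval_fps (fps_X * F) t = t * eval_fps F t" if "ereal (norm t) < fps_conv_radius F" for F :: "real fps"
    using that by (subst eval_fps_mult) auto
  have EC: "eval_fps (fps_const c * F) t = c * eval_fps F t" if "ereal (norm t) < fps_conv_radius F" for F :: "real fps" and c
    using that by (subst eval_fps_mult) auto
  show "(S_ser v m has_field_derivative eval_fps (fps_deriv (S_fps v m)) t) (at t)"
    unfolding S_ser_def[abs_def] by (intro has_field_derivative_eval_fps R)
  have "fps_deriv (S_fps v m) - fps_X * fps_deriv (S_fps v m) =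
          fps_const (real m) * S_fps v m - fps_const (real m) * S_fps v (Suc m)"
  proof (rule fps_ext)
    fix k
    show "fps_nth (fps_deriv (S_fps v m) - fps_X * fps_deriv (S_fps v m)) k =
          fps_nth (fps_const (real m) * S_fps v m - fps_const (real m) * S_fps v (Suc m)) k"
      using S_fps_raise_nth[of v k m] assms
      by (cases k) (auto simp: algebra_simps)
  qed
  from arg_cong[OF this, of "\<lambda>F. eval_fps F t"]
  show "(1 - t) * eval_fps (fps_deriv (S_fps v m)) t =
           real m * (S_ser v m t - S_ser v (Suc m) t)"
    by (simp only: eval_fps_diff EX EC S_ser_def conv) (simp add: algebra_simps)
  have "fps_X * (fps_deriv (S_fps v (Suc m)) - fps_X * fps_deriv (S_fps v (Suc m))) =
          fps_const (m + 2 * v - 1) * S_fps v m - (fps_const (m + v) * S_fps v (Suc m)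
            + fps_const (v - 1) * (fps_X * S_fps v (Suc m)))"
  proof (rule fps_ext)
    fix k
    show "fps_nth (fps_X * (fps_deriv (S_fps v (Suc m)) - fps_X * fps_deriv (S_fps v (Suc m)))) k =
        fps_nth (fps_const (m + 2 * v - 1) * S_fps v m - (fps_const (m + v) * S_fps v (Suc m)
            + fps_const (v - 1) * (fps_X * S_fps v (Suc m)))) k"
    proof (cases k)
      case 0
      \<comment> \<open>Constant term: (m + 2v - 1) S_m(0) = (m + v) S_(m+1)(0), a relation between
        the prefactors.\<close>
      have "pochhammer v m > 0" "v + real m > 0"
        using assms by (auto intro!: pochhammer_pos add_pos_nonneg)
      with 0 show ?thesis by (simp add: S_fps_def pochhammer_Suc divide_simps) (simp add: algebra_simps)
    next
      case (Suc j)
      thus ?thesis using S_fps_lower_nth[of v j m] assms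
        by (cases j) (simp_all add: algebra_simps)
    qed
  qed
  from arg_cong[OF this, of "\<lambda>F. eval_fps F t"]
  show "t * (1 - t) * eval_fps (fps_deriv (S_fps v (Suc m))) t =
           (m + 2 * v - 1) * S_ser v m t - (m + v + (v - 1) * t) * S_ser v (Suc m) t"
    by (simp only: eval_fps_diff eval_fps_add EX EC S_ser_def conv) (simp add: algebra_simps)
qed

section \<open>Recurrences for the integrals\<close>

text \<open>A gauge integral over the closed interval, to which the fundamental theorem of calculus
  applies directly; \<open>0 powr a = 0\<close> makes the endpoints harmless for negative exponents
  too.\<close>

definition beta_integral :: "real \<Rightarrow> real \<Rightarrow> (real \<Rightarrow> real) \<Rightarrow> real" where
  "beta_integral a b g = integral {0..1} (\<lambda>t. t powr a * (1 - t) powr b * g t)"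

lemma beta_weight_integrable:
  assumes "a > -1" "b > -1" "continuous_on {0..1} g"
  shows "set_integrable lborel {0..1} (\<lambda>t::real. t powr a * (1 - t) powr b * g t)"
proof -
  have "bounded (g ` {0..1})"
    using assms(3) by (intro compact_imp_bounded compact_continuous_image) auto
  then obtain C where C: "\<And>t. t \<in> {0..1} \<Longrightarrow> norm (g t) \<le> C"
    unfolding bounded_iff by blast
  have "set_integrable lborel {0..1} (\<lambda>t::real. t powr (a + 1 - 1) * (1 - t) powr (b + 1 - 1))"
    using assms by (intro integrable_Beta) auto
  hence *: "integrable lborel (\<lambda>t. C * (indicator {0..1} t *\<^sub>R (t powr a * (1 - t) powr b)))"
    unfolding set_integrable_def by (intro integrable_mult_right) simp
  have [measurable]: "(\<lambda>t. indicator {0..1} t *\<^sub>R g t) \<in> borel_measurable borel"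
    using assms(3) by (intro borel_measurable_continuous_on_indicator) auto
  show ?thesis
    unfolding set_integrable_def
  proof (rule Bochner_Integration.integrable_bound[OF * _ AE_I2])
    have "(\<lambda>t. (t powr a * (1 - t) powr b) * (indicator {0..1} t *\<^sub>R g t)) \<in> borel_measurable lborel"
      by measurable
    thus "(\<lambda>t. indicator {0..1} t *\<^sub>R (t powr a * (1 - t) powr b * g t)) \<in> borel_measurable lborel"
      by (simp add: mult_ac)
    fix t :: real
    show "norm (indicator {0..1} t *\<^sub>R (t powr a * (1 - t) powr b * g t))
        \<le> norm (C * indicator {0..1} t *\<^sub>R (t powr a * (1 - t) powr b))"
    proof (cases "t \<in> {0..1}")
      case True
      with C[OF True] have "norm (g t) \<le> \<bar>C\<bar>" by linarith
      hence "norm (g t) * (t powr a * (1 - t) powr b) \<le> \<bar>C\<bar> * (t powr a * (1 - t) powr b)"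
        by (intro mult_right_mono) auto
      thus ?thesis using True by (simp add: abs_mult mult_ac)
    qed simp
  qed
qed

lemma has_beta_integral:
  assumes "a > -1" "b > -1" "continuous_on {0..1} g"
  shows "((\<lambda>t. t powr a * (1 - t) powr b * g t) has_integral beta_integral a b g) {0..1}"
  using set_borel_integral_eq_integral(1)[OF beta_weight_integrable[OF assms]]
  unfolding beta_integral_def by (rule integrable_integral)

lemma LINT_eq_beta_integral:
  assumes "a > -1" "b > -1" "continuous_on {0..1} g"
  shows "(LINT t:{0<..<1}|lborel. t powr a * (1 - t) powr b * g t) = beta_integral a b g"
proof -
  have "set_integrable lborel {0<..<1} (\<lambda>t. t powr a * (1 - t) powr b * g t)"
    by (rule set_integrable_subset[OF beta_weight_integrable[OF assms]]) auto
  from set_borel_integral_eq_integral(2)[OF this] show ?thesis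
    unfolding beta_integral_def by (simp add: integral_open_interval_real)
qed

lemma beta_integral_one:
  assumes "a > -1" "b > -1"
  shows "beta_integral a b (\<lambda>_. c) = c * Beta (a + 1) (b + 1)"
proof -
  have "((\<lambda>t. t powr (a + 1 - 1) * (1 - t) powr (b + 1 - 1) * c) has_integral (Beta (a + 1) (b + 1) * c)) {0..1}"
    using assms by (intro has_integral_mult_left has_integral_Beta_real) auto
  from integral_unique[OF this] show ?thesis unfolding beta_integral_def by (simp only: add_diff_cancel_right' mult.commute)
qed

text \<open>The primitive t^p (1 - t)^q g vanishes at both endpoints, as p and q are positive. A
  recurrence between integrals thereby becomes an algebraic identity for the integrand with the
  powers factored out.\<close>

lemma has_integral_beta_total_derivative:
  fixes g g' :: "real \<Rightarrow> real"
  assumes "p > 0" "q > 0" "continuous_on {0..1} g"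
    and "\<And>t. t \<in> {0<..<1} \<Longrightarrow> (g has_field_derivative g' t) (at t)"
    and "\<And>t. t \<in> {0<..<1} \<Longrightarrow> t powr (p - 1) * (1 - t) powr (q - 1) *
           ((p * (1 - t) - q * t) * g t + t * (1 - t) * g' t) = h t"
  shows "(h has_integral 0) {0..1}"
proof -
  define H where "H = (\<lambda>t. t powr p * (1 - t) powr q * g t)"
  have "(h has_integral (H 1 - H 0)) {0..1}"
  proof (rule fundamental_theorem_of_calculus_interior)
    show "continuous_on {0..1} H"
      unfolding H_def using assms(1-3) by (intro continuous_intros continuous_on_powr') auto
    fix t :: real assume t: "t \<in> {0<..<1}"
    have e: "t powr p = t powr (p - 1) * t" "(1 - t) powr q = (1 - t) powr (q - 1) * (1 - t)"
      using t powr_add[of t "p - 1" 1] powr_add[of "1 - t" "q - 1" 1] by auto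
    have "(H has_field_derivative
        (p * t powr (p - 1)) * ((1 - t) powr q) * g t + t powr p * (- q * (1 - t) powr (q - 1)) * g t
         + t powr p * (1 - t) powr q * g' t) (at t)"
      unfolding H_def using t
      by (auto intro!: derivative_eq_intros assms(4) simp: algebra_simps)
    also have "(p * t powr (p - 1)) * ((1 - t) powr q) * g t + t powr p * (- q * (1 - t) powr (q - 1)) * g t
         + t powr p * (1 - t) powr q * g' t =
       t powr (p - 1) * (1 - t) powr (q - 1) * ((p * (1 - t) - q * t) * g t + t * (1 - t) * g' t)"
      unfolding e by (simp add: algebra_simps)
    also have "\<dots> = h t" by (rule assms(5)[OF t])
    finally show "(H has_vector_derivative h t) (at t)"
      by (simp only: has_real_derivative_iff_has_vector_derivative)
  qed auto
  thus ?thesis using assms(1,2) by (simp add: H_def)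
qed

section \<open>Recurrences in m and in s\<close>

text \<open>The integral in I_m without its Gamma prefactor, which does not depend on m and hence
  does not affect the recurrence in m.\<close>

definition S_moment :: "real \<Rightarrow> nat \<Rightarrow> real \<Rightarrow> real" where
  "S_moment v m s = beta_integral (real m + v - 1) s (\<lambda>t. (S_ser v m t)\<^sup>2)"

lemma powr_add_1: "t powr (a + 1) = t powr a * t" if "t > 0" for t :: real
  using that by (simp add: powr_add)

lemma S_moment_rec:
  fixes v s :: real and j :: nat
  defines "m \<equiv> real j + 1" and "\<kappa> \<equiv> real j + v" and "\<mu> \<equiv> real j + 2 * v - 1" and "\<sigma> \<equiv> s + 2 * v"
  defines "Q \<equiv> m\<^sup>2 + (2 * v - 2) * m + 1 - v + \<sigma> * (1 - \<sigma>) / 2"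
  assumes v: "v > 1 / 2" "v \<notin> \<int>" and s: "s > -1"
  shows "m\<^sup>2 * (\<kappa> + \<sigma>) * S_moment v (Suc (Suc j)) s - 2 * \<kappa> * Q * S_moment v (Suc j) s
           + \<mu>\<^sup>2 * (\<kappa> - \<sigma>) * S_moment v j s = 0"
proof -
  define X where "X = S_ser v j"
  define Y where "Y = S_ser v (Suc j)"
  define Z where "Z = S_ser v (Suc (Suc j))"
  define X' where "X' = (\<lambda>t. eval_fps (fps_deriv (S_fps v j)) t)"
  define Y' where "Y' = (\<lambda>t. eval_fps (fps_deriv (S_fps v (Suc j))) t)"
  \<comment> \<open>The certificate: \<open>t powr \<kappa> * (1 - t) powr (s + 1) * g t\<close> is
    the primitive. Its coefficients are such that the derivative, once freed of \<open>X'\<close>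
    and \<open>Y'\<close>, is a combination of the squares of S_j, S_(j+1) and S_(j+2)
    alone.\<close>
  define g where "g = (\<lambda>t. \<kappa> * (2 * \<mu> * X t * Y t - (\<kappa> + \<sigma>) * (Y t)\<^sup>2 - \<kappa> * t * (Y t)\<^sup>2))"
  define g' where "g' = (\<lambda>t. \<kappa> * (2 * \<mu> * (X' t * Y t + X t * Y' t) - 2 * (\<kappa> + \<sigma>) * Y t * Y' t
     - \<kappa> * (Y t)\<^sup>2 - 2 * \<kappa> * t * Y t * Y' t))"
  define h where "h = (\<lambda>t. m\<^sup>2 * (\<kappa> + \<sigma>) * (t powr (\<kappa> + 1) * (1 - t) powr s * (Z t)\<^sup>2)
     - 2 * \<kappa> * Q * (t powr \<kappa> * (1 - t) powr s * (Y t)\<^sup>2)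
     + \<mu>\<^sup>2 * (\<kappa> - \<sigma>) * (t powr (\<kappa> - 1) * (1 - t) powr s * (X t)\<^sup>2))"
  have cont [continuous_intros]: "continuous_on {0..1} X" "continuous_on {0..1} Y" "continuous_on {0..1} Z"
    unfolding X_def Y_def Z_def by (intro continuous_on_S_ser v)+
  have \<kappa>: "\<kappa> > 0" using v by (simp add: \<kappa>_def)
  have "(h has_integral 0) {0..1}"
  proof (rule has_integral_beta_total_derivative[where p = \<kappa> and q = "s + 1" and g = g and g' = g'])
    fix t :: real assume t: "t \<in> {0<..<1}"
    hence t': "\<bar>t\<bar> < 1" by auto
    have dX: "(X has_field_derivative X' t) (at t)" and dY: "(Y has_field_derivative Y' t) (at t)"
      unfolding X_def Y_def X'_def Y'_def by (intro S_ser_has_derivative v t')+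
    show "(g has_field_derivative g' t) (at t)"
      unfolding g_def g'_def
      by (auto intro!: derivative_eq_intros dX dY simp: algebra_simps power2_eq_square)
    have eX: "(1 - t) * X' t = j * (X t - Y t)"
      unfolding X_def Y_def X'_def using S_ser_raise[OF v t'] .
    have eY: "(1 - t) * Y' t = m * (Y t - Z t)"
      unfolding Z_def Y_def Y'_def m_def using S_ser_raise[OF v t', of "Suc j"] by (simp add: add.commute)
    have eY2: "t * (1 - t) * Y' t = \<mu> * X t - (\<kappa> + (v - 1) * t) * Y t"
      unfolding X_def Y_def Y'_def \<mu>_def \<kappa>_def using S_ser_lower[OF v t'] .
    define T where "T = \<mu> * X t - (\<kappa> + (v - 1) * t) * Y t"
    \<comment> \<open>The raising and the lowering relation both express the derivative of S_(j+1);
      equating them gives S_(j+2) in terms of S_(j+1) and S_j.\<close>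
    have "t * m * Z t = t * m * Y t - T"
    proof -
      have "T = t * ((1 - t) * Y' t)"
        using eY2 unfolding T_def by (simp only: mult.assoc)
      thus ?thesis unfolding eY by (simp add: algebra_simps)
    qed
    hence eZ: "t * m * Z t = \<kappa> * (1 + t) * Y t - \<mu> * X t"
      unfolding T_def \<kappa>_def m_def by (simp add: algebra_simps)
    have "t * (1 - t) * g' t = \<kappa> * (2 * \<mu> * (t * ((1 - t) * X' t) * Y t + X t * (t * (1 - t) * Y' t))
      - 2 * (\<kappa> + \<sigma>) * Y t * (t * (1 - t) * Y' t) - \<kappa> * (t * (1 - t)) * (Y t)\<^sup>2
      - 2 * \<kappa> * t * Y t * (t * (1 - t) * Y' t))"
      unfolding g'_def by (simp add: algebra_simps)
    also have "\<dots> = \<kappa> * (2 * \<mu> * (t * (j * (X t - Y t)) * Y t + X t * T)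
      - 2 * (\<kappa> + \<sigma>) * Y t * T - \<kappa> * (t * (1 - t)) * (Y t)\<^sup>2 - 2 * \<kappa> * t * Y t * T)"
      unfolding eX eY2 T_def ..
    \<comment> \<open>On the right the mixed term in \<open>X t * Y t\<close> occurs only inside the
      square that equals (t m Z)^2.\<close>
    finally have "(\<kappa> * (1 - t) - (s + 1) * t) * g t + t * (1 - t) * g' t =
       (\<kappa> + \<sigma>) * (\<kappa> * (1 + t) * Y t - \<mu> * X t)\<^sup>2 - 2 * \<kappa> * Q * t * (Y t)\<^sup>2 + \<mu>\<^sup>2 * (\<kappa> - \<sigma>) * (X t)\<^sup>2"
      unfolding g_def T_def Q_def \<sigma>_def \<kappa>_def \<mu>_def m_def
      by (simp add: field_simps power2_eq_square)
    hence id: "(\<kappa> * (1 - t) - (s + 1) * t) * g t + t * (1 - t) * g' t =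
       m\<^sup>2 * (\<kappa> + \<sigma>) * (t\<^sup>2 * (Z t)\<^sup>2) - 2 * \<kappa> * Q * (t * (Y t)\<^sup>2) + \<mu>\<^sup>2 * (\<kappa> - \<sigma>) * (X t)\<^sup>2"
      unfolding eZ[symmetric] by (simp add: power2_eq_square mult_ac)
    have p: "t powr (\<kappa> + 1) = t powr (\<kappa> - 1) * t\<^sup>2" "t powr \<kappa> = t powr (\<kappa> - 1) * t"
      using t powr_add_1[of t "\<kappa> - 1"] powr_add_1[of t \<kappa>] by (auto simp: power2_eq_square)
    show "t powr (\<kappa> - 1) * (1 - t) powr (s + 1 - 1) *
        ((\<kappa> * (1 - t) - (s + 1) * t) * g t + t * (1 - t) * g' t) = h t"
      unfolding id h_def p by (simp add: algebra_simps)
  qed (use s \<kappa> in \<open>auto simp: g_def intro!: continuous_intros\<close>)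
  moreover have "(h has_integral (m\<^sup>2 * (\<kappa> + \<sigma>) * S_moment v (Suc (Suc j)) s - 2 * \<kappa> * Q * S_moment v (Suc j) s
           + \<mu>\<^sup>2 * (\<kappa> - \<sigma>) * S_moment v j s)) {0..1}"
    unfolding h_def S_moment_def X_def[symmetric] Y_def[symmetric] Z_def[symmetric]
    using \<kappa> s
    by (intro has_integral_add has_integral_diff has_integral_mult_right)
       (rule has_beta_integral[THEN has_integral_eq_rhs]; auto simp: \<kappa>_def add_ac intro!: continuous_intros)+
  ultimately show ?thesis
    by (simp add: has_integral_unique)
qed

text \<open>The neighbour S_0 is 1, so the lowering relation is a first-order equation for S_1
  alone. A first total derivative evaluates the linear moment of S_1 as a multiple of a Beta value;
  a second one, built on the square, closes up into a recurrence in s with that value as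
  inhomogeneity.\<close>

lemma S_moment_1_step:
  assumes v: "v > 1 / 2" "v \<notin> \<int>" and s: "s > -1"
  shows "(v + s + 2 * v) * S_moment v 1 (s + 1) - (s + 4 * v - 1) * S_moment v 1 s
           + 2 * (2 * v - 1)\<^sup>2 / (s + 2 * v) * Beta v (s + 1) = 0"
proof -
  define Y where "Y = S_ser v 1"
  define Y' where "Y' = (\<lambda>t. eval_fps (fps_deriv (S_fps v 1)) t)"
  define c where "c = 2 * v - 1"
  define M where "M = beta_integral v s Y"
  have cont [continuous_intros]: "continuous_on {0..1} Y"
    unfolding Y_def by (intro continuous_on_S_ser v)
  have dY: "(Y has_field_derivative Y' t) (at t)"
    and eY: "t * (1 - t) * Y' t = c - (v + (v - 1) * t) * Y t" if "t \<in> {0<..<1}" for t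
    using S_ser_has_derivative[OF v, of t 1] S_ser_lower[OF v, of t 0] that
    by (auto simp: Y_def Y'_def c_def)
  have J: "S_moment v 1 s' = beta_integral v s' (\<lambda>t. (Y t)\<^sup>2)" for s'
    by (simp add: S_moment_def Y_def)
  have "((\<lambda>t. c * (t powr (v - 1) * (1 - t) powr s * 1) - (s + 2 * v) * (t powr v * (1 - t) powr s * Y t))
         has_integral 0) {0..1}"
  proof (rule has_integral_beta_total_derivative[where p = v and q = "s + 1" and g = Y and g' = Y'])
    fix t :: real assume t: "t \<in> {0<..<1}"
    have p: "t powr v = t powr (v - 1) * t"
      using powr_add_1[of t "v - 1"] t by simp
    show "t powr (v - 1) * (1 - t) powr (s + 1 - 1) *
           ((v * (1 - t) - (s + 1) * t) * Y t + t * (1 - t) * Y' t) =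
          c * (t powr (v - 1) * (1 - t) powr s * 1) - (s + 2 * v) * (t powr v * (1 - t) powr s * Y t)"
      unfolding eY[OF t] p by (simp add: algebra_simps)
  qed (use v s dY in \<open>auto intro!: continuous_intros\<close>)
  moreover have "((\<lambda>t. c * (t powr (v - 1) * (1 - t) powr s * 1) - (s + 2 * v) * (t powr v * (1 - t) powr s * Y t))
         has_integral (c * beta_integral (v - 1) s (\<lambda>_. 1) - (s + 2 * v) * M)) {0..1}"
    unfolding M_def using v s
    by (intro has_integral_add has_integral_diff has_integral_mult_right has_beta_integral)
       (auto intro!: continuous_intros)
  ultimately have "c * beta_integral (v - 1) s (\<lambda>_. 1) - (s + 2 * v) * M = 0"
    by (rule has_integral_unique[symmetric])
  hence "c * Beta v (s + 1) - (s + 2 * v) * M = 0"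
    using v s by (simp add: beta_integral_one)
  hence M: "M = c / (s + 2 * v) * Beta v (s + 1)"
    using v s by (simp add: field_simps)
  have "((\<lambda>t. (v + s + 2 * v) * (t powr v * (1 - t) powr (s + 1) * (Y t)\<^sup>2) -
           (s + 4 * v - 1) * (t powr v * (1 - t) powr s * (Y t)\<^sup>2) +
           2 * c * (t powr v * (1 - t) powr s * Y t)) has_integral 0) {0..1}"
  proof (rule has_integral_beta_total_derivative[where p = "v + 1" and q = "s + 1"
        and g = "\<lambda>t. (Y t)\<^sup>2" and g' = "\<lambda>t. 2 * Y t * Y' t"])
    fix t :: real assume t: "t \<in> {0<..<1}"
    show "((\<lambda>t. (Y t)\<^sup>2) has_field_derivative 2 * Y t * Y' t) (at t)"
      using dY[OF t] by (auto intro!: derivative_eq_intros)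
    have p: "(1 - t) powr (s + 1) = (1 - t) powr s * (1 - t)"
      using powr_add_1[of "1 - t" s] t by simp
    have e: "t * (1 - t) * (2 * Y t * Y' t) = 2 * Y t * (c - (v + (v - 1) * t) * Y t)"
      unfolding eY[OF t, symmetric] by (simp add: mult_ac)
    show "t powr (v + 1 - 1) * (1 - t) powr (s + 1 - 1) *
         (((v + 1) * (1 - t) - (s + 1) * t) * (Y t)\<^sup>2 + t * (1 - t) * (2 * Y t * Y' t)) =
        (v + s + 2 * v) * (t powr v * (1 - t) powr (s + 1) * (Y t)\<^sup>2) -
           (s + 4 * v - 1) * (t powr v * (1 - t) powr s * (Y t)\<^sup>2) +
           2 * c * (t powr v * (1 - t) powr s * Y t)"
      unfolding e p by (simp add: algebra_simps power2_eq_square)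
  qed (use v s in \<open>auto intro!: continuous_intros\<close>)
  moreover have "((\<lambda>t. (v + s + 2 * v) * (t powr v * (1 - t) powr (s + 1) * (Y t)\<^sup>2) -
           (s + 4 * v - 1) * (t powr v * (1 - t) powr s * (Y t)\<^sup>2) +
           2 * c * (t powr v * (1 - t) powr s * Y t)) has_integral
         ((v + s + 2 * v) * S_moment v 1 (s + 1) - (s + 4 * v - 1) * S_moment v 1 s + 2 * c * M)) {0..1}"
    unfolding M_def J using v s
    by (intro has_integral_add has_integral_diff has_integral_mult_right has_beta_integral)
       (auto intro!: continuous_intros)
  ultimately have "(v + s + 2 * v) * S_moment v 1 (s + 1) - (s + 4 * v - 1) * S_moment v 1 s + 2 * c * M = 0"
    by (rule has_integral_unique[symmetric])
  thus ?thesis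
    unfolding M c_def[symmetric] by (simp add: power2_eq_square)
qed

text \<open>S_1 is bounded on [0,1], and (1 - t)^s has integral 1/(s + 1). The decay selects the
  right solution of the recurrence in s, which by itself leaves a periodic term open.\<close>

lemma S_moment_1_bound:
  assumes v: "v > 1 / 2" "v \<notin> \<int>"
  obtains C where "\<And>s. s > -1 \<Longrightarrow> \<bar>S_moment v 1 s\<bar> \<le> C / (s + 1)"
proof -
  have "bounded (S_ser v 1 ` {0..1})"
    using continuous_on_S_ser[OF v] by (intro compact_imp_bounded compact_continuous_image) auto
  then obtain C where C: "\<And>t. t \<in> {0..1} \<Longrightarrow> norm (S_ser v 1 t) \<le> C"
    unfolding bounded_iff by blast
  have cont: "continuous_on {0..1} (\<lambda>t. (S_ser v 1 t)\<^sup>2)"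
    using continuous_on_S_ser[OF v] by (intro continuous_intros)
  have "\<bar>S_moment v 1 s\<bar> \<le> C\<^sup>2 / (s + 1)" if s: "s > -1" for s
  proof -
    have J: "((\<lambda>t. t powr v * (1 - t) powr s * (S_ser v 1 t)\<^sup>2) has_integral S_moment v 1 s) {0..1}"
      unfolding S_moment_def using v s has_beta_integral[OF _ s cont, of v] by simp
    have B: "((\<lambda>t. t powr 0 * (1 - t) powr s * C\<^sup>2) has_integral (C\<^sup>2 * Beta 1 (s + 1))) {0..1}"
      using has_beta_integral[of 0 s "\<lambda>_. C\<^sup>2"] s by (simp add: beta_integral_one)
    have "0 \<le> S_moment v 1 s"
      by (rule has_integral_nonneg[OF J]) auto
    moreover have "S_moment v 1 s \<le> C\<^sup>2 * Beta 1 (s + 1)"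
    proof (rule has_integral_le[OF J B])
      fix t :: real assume t: "t \<in> {0..1}"
      show "t powr v * (1 - t) powr s * (S_ser v 1 t)\<^sup>2 \<le> t powr 0 * (1 - t) powr s * C\<^sup>2"
      proof (cases "t = 0")
        case False
        have "(S_ser v 1 t)\<^sup>2 \<le> C\<^sup>2"
          using C[OF t] by (metis abs_le_square_iff abs_of_nonneg norm_ge_zero order_trans real_norm_def)
        moreover have "t powr v \<le> 1"
          using t v by (simp add: powr_le1)
        ultimately show ?thesis using t False
          by (intro mult_mono) auto
      qed (use v in auto)
    qed
    moreover have "Beta 1 (s + 1) = 1 / (s + 1)"
    proof -
      have "Gamma (s + 1 + 1) = (s + 1) * Gamma (s + 1)"
        using s by (intro Gamma_plus1) auto
      moreover have "Gamma (s + 1) \<noteq> 0" using s by (intro less_imp_neq[THEN not_sym] Gamma_real_pos) auto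
      ultimately show ?thesis using s
        by (simp add: Beta_def add.commute[of 1] add.assoc[symmetric])
    qed
    ultimately show ?thesis by simp
  qed
  thus ?thesis using that by blast
qed

section \<open>The first integral\<close>

text \<open>Lagrange interpolation at the points of \<open>K\<close> reproduces \<open>p\<close>,
  whose degree is below the number of nodes; dividing by the full product leaves simple
  fractions.\<close>

lemma partial_fractions_simple:
  fixes p :: "'a :: field poly"
  assumes "finite K" "degree p < card K" "w \<notin> K"
  shows "poly p w / (\<Prod>a\<in>K. w - a) = (\<Sum>a\<in>K. poly p a / (\<Prod>b\<in>K-{a}. a - b) / (w - a))"
proof -
  define q where "q = (\<Sum>a\<in>K. smult (poly p a / (\<Prod>b\<in>K-{a}. a - b)) (\<Prod>b\<in>K-{a}. [:-b, 1:]))"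
  have nz: "(\<Prod>b\<in>K-{a}. a - b) \<noteq> 0" for a
    using assms(1) by auto
  have "p = q"
  proof (rule poly_eqI_degree[of K])
    fix x assume x: "x \<in> K"
    have "poly q x = (\<Sum>a\<in>K. if a = x then poly p x else 0)"
      unfolding q_def poly_sum
    proof (rule sum.cong)
      fix a assume a: "a \<in> K"
      show "poly (smult (poly p a / (\<Prod>b\<in>K-{a}. a - b)) (\<Prod>b\<in>K-{a}. [:-b, 1:])) x =
          (if a = x then poly p x else 0)"
      proof (cases "a = x")
        case False
        with x assms(1) have "(\<Prod>b\<in>K-{a}. x - b) = 0" by auto
        thus ?thesis using False by (simp add: poly_prod)
      qed (use nz[of x] in \<open>simp add: poly_prod\<close>)
    qed auto
    thus "poly p x = poly q x" using x assms(1) by simp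
  next
    show "card K > degree p" by fact
    have "degree q \<le> card K - 1"
      unfolding q_def
    proof (intro degree_sum_le)
      fix a assume a: "a \<in> K"
      have "degree (\<Prod>b\<in>K-{a}. [:-b, 1:]) \<le> (\<Sum>b\<in>K-{a}. degree [:-b, 1:])"
        using assms(1) by (intro degree_prod_sum_le[simplified o_def]) auto
      also have "\<dots> = card K - 1" using a by simp
      finally show "degree (smult (poly p a / (\<Prod>b\<in>K-{a}. a - b)) (\<Prod>b\<in>K-{a}. [:-b, 1:])) \<le> card K - 1"
        using degree_smult_le order_trans by blast
    qed (fact assms)
    thus "card K > degree q" using assms(2) by linarith
  qed
  hence "poly p w = poly q w" by simp
  also have "\<dots> = (\<Sum>a\<in>K. poly p a / (\<Prod>b\<in>K-{a}. a - b) * (\<Prod>b\<in>K-{a}. w - b))"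
    by (simp add: q_def poly_sum poly_prod)
  also have "\<dots> / (\<Prod>a\<in>K. w - a) =
      (\<Sum>a\<in>K. poly p a / (\<Prod>b\<in>K-{a}. a - b) * ((\<Prod>b\<in>K-{a}. w - b) / (\<Prod>a\<in>K. w - a)))"
    by (simp add: sum_divide_distrib)
  also have "\<dots> = (\<Sum>a\<in>K. poly p a / (\<Prod>b\<in>K-{a}. a - b) / (w - a))"
  proof (rule sum.cong)
    fix a assume a: "a \<in> K"
    have "(\<Prod>a\<in>K. w - a) = (w - a) * (\<Prod>b\<in>K-{a}. w - b)"
      using a assms(1) by (intro prod.remove)
    moreover have "(\<Prod>b\<in>K-{a}. w - b) \<noteq> 0" "w - a \<noteq> 0"
      using assms a by auto
    ultimately show "poly p a / (\<Prod>b\<in>K-{a}. a - b) * ((\<Prod>b\<in>K-{a}. w - b) / (\<Prod>a\<in>K. w - a)) =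
       poly p a / (\<Prod>b\<in>K-{a}. a - b) / (w - a)" by simp
  qed auto
  finally show ?thesis .
qed

text \<open>From here on \<open>n = 2 * h + 1\<close>.\<close>

definition R_fun :: "nat \<Rightarrow> real \<Rightarrow> real" where
  "R_fun h y = (\<Prod>j<h. y\<^sup>2 - (real j + 1 / 2)\<^sup>2) / (\<Prod>k\<le>2*h. y\<^sup>2 - (real k)\<^sup>2)"

text \<open>Partial fraction coefficients in the variable y^2, whose nodes k^2 are distinct. In
  terms of y, the node 0 is a double pole.\<close>

definition R_coeff :: "nat \<Rightarrow> nat \<Rightarrow> real" where
  "R_coeff h k = (\<Prod>j<h. (real k)\<^sup>2 - (real j + 1 / 2)\<^sup>2) / (\<Prod>i\<in>{..2*h}-{k}. (real k)\<^sup>2 - (real i)\<^sup>2)"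

lemma R_fun_partial_fractions:
  assumes "\<And>k. k \<le> 2 * h \<Longrightarrow> y\<^sup>2 \<noteq> (real k)\<^sup>2"
  shows "R_fun h y = (\<Sum>k\<le>2*h. R_coeff h k / (y\<^sup>2 - (real k)\<^sup>2))"
proof -
  define f where "f = (\<lambda>k::nat. (real k)\<^sup>2)"
  have inj: "inj_on f A" for A
    by (auto simp: inj_on_def f_def)
  define p where "p = (\<Prod>j<h. [:- (real j + 1 / 2)\<^sup>2, 1:])"
  have p: "poly p w = (\<Prod>j<h. w - (real j + 1 / 2)\<^sup>2)" for w
    by (simp add: p_def poly_prod)
  have card: "card (f ` {..2*h}) = 2 * h + 1"
    by (subst card_image[OF inj]) auto
  have "degree p \<le> (\<Sum>j<h. degree [:- (real j + 1 / 2)\<^sup>2, 1:])"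
    unfolding p_def by (intro degree_prod_sum_le[simplified o_def]) auto
  hence deg: "degree p < card (f ` {..2*h})"
    unfolding card by simp
  have "R_fun h y = poly p (y\<^sup>2) / (\<Prod>a\<in>f ` {..2*h}. y\<^sup>2 - a)"
    by (simp add: R_fun_def p prod.reindex[OF inj]) (simp add: f_def)
  also have "\<dots> = (\<Sum>a\<in>f ` {..2*h}. poly p a / (\<Prod>b\<in>f ` {..2*h}-{a}. a - b) / (y\<^sup>2 - a))"
    using assms deg by (intro partial_fractions_simple) (auto simp: f_def)
  also have "\<dots> = (\<Sum>k\<le>2*h. poly p (f k) / (\<Prod>b\<in>f ` {..2*h}-{f k}. f k - b) / (y\<^sup>2 - f k))"
    by (simp add: sum.reindex[OF inj])
  also have "\<dots> = (\<Sum>k\<le>2*h. R_coeff h k / (y\<^sup>2 - (real k)\<^sup>2))"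
  proof (intro sum.cong refl)
    fix k assume "k \<in> {..2*h}"
    hence "f ` {..2*h}-{f k} = f ` ({..2*h}-{k})"
      by (simp add: image_set_diff[OF inj])
    hence "(\<Prod>b\<in>f ` {..2*h}-{f k}. f k - b) = (\<Prod>i\<in>{..2*h}-{k}. f k - f i)"
      by (simp add: prod.reindex[OF inj])
    thus "poly p (f k) / (\<Prod>b\<in>f ` {..2*h}-{f k}. f k - b) / (y\<^sup>2 - f k) = R_coeff h k / (y\<^sup>2 - (real k)\<^sup>2)"
      by (simp add: R_coeff_def p f_def)
  qed
  finally show ?thesis .
qed

section \<open>Summation of R over integer shifts\<close>

text \<open>Closed form of the sum of R(y + i) over i >= 0. The double pole gives the trigamma
  function; for k > 0 the fraction splits into multiples of 1/(y - k) - 1/(y + k), whose sum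
  telescopes to 2k terms. The type is general because real arguments serve the integrals and complex
  ones their continuation.\<close>

definition Z_fun :: "nat \<Rightarrow> 'a :: {real_normed_field, banach} \<Rightarrow> 'a" where
  "Z_fun h y = of_real (R_coeff h 0) * Polygamma 1 y +
     (\<Sum>k=1..2*h. of_real (R_coeff h k / (2 * real k)) * (\<Sum>j<2*k. 1 / (y - of_nat k + of_nat j)))"

lemma Z_fun_of_real: "y \<noteq> 0 \<Longrightarrow> Z_fun h (of_real y) = of_real (Z_fun h y)"
  unfolding Z_fun_def by (simp add: Polygamma_of_real)

text \<open>Passing from y to y + 1 shifts each block of 2k fractions by one, so only its two end
  terms survive; they form the partial fraction of R for k.\<close>

lemma Z_fun_step:
  fixes y :: real
  assumes "\<And>k. k \<le> 2 * h \<Longrightarrow> y\<^sup>2 \<noteq> (real k)\<^sup>2"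
  shows "Z_fun h y - Z_fun h (y + 1) = R_fun h y"
proof -
  have y0: "y \<noteq> 0" using assms[of 0] by auto
  have *: "(\<Sum>j<2*k. 1 / (y - real k + real j)) - (\<Sum>j<2*k. 1 / (y + 1 - real k + real j))
           = 2 * real k / (y\<^sup>2 - (real k)\<^sup>2)" if "k \<le> 2 * h" for k
  proof -
    have ne: "y - k \<noteq> 0" "y + k \<noteq> 0"
      using assms[OF that] by (auto simp: power2_eq_square add_eq_0_iff2)
    have "(\<Sum>j<2*k. 1 / (y - real k + real j)) - (\<Sum>j<2*k. 1 / (y + 1 - real k + real j))
       = (\<Sum>j<2*k. 1 / (y - real k + real j) - 1 / (y - real k + real (Suc j)))"
      by (simp add: sum_subtractf algebra_simps)
    also have "\<dots> = 1 / (y - real k) - 1 / (y + real k)"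
      by (subst sum_lessThan_telescope') simp
    also have "\<dots> = 2 * real k / ((y - k) * (y + k))"
      using ne by (simp add: divide_simps)
    finally show ?thesis by (simp add: power2_eq_square algebra_simps)
  qed
  have "Z_fun h y - Z_fun h (y + 1) = R_coeff h 0 * (Polygamma 1 y - Polygamma 1 (y + 1)) +
     (\<Sum>k=1..2*h. R_coeff h k / (2 * real k) * ((\<Sum>j<2*k. 1 / (y - real k + real j)) -
        (\<Sum>j<2*k. 1 / (y + 1 - real k + real j))))"
    unfolding Z_fun_def by (simp add: algebra_simps sum_subtractf)
  also have "Polygamma 1 y - Polygamma 1 (y + 1) = 1 / y\<^sup>2"
    using Polygamma_plus1[of y 1] y0 by (simp add: power2_eq_square)
  also have "(\<Sum>k=1..2*h. R_coeff h k / (2 * real k) * ((\<Sum>j<2*k. 1 / (y - real k + real j)) -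
        (\<Sum>j<2*k. 1 / (y + 1 - real k + real j)))) = (\<Sum>k=1..2*h. R_coeff h k / (y\<^sup>2 - (real k)\<^sup>2))"
    by (intro sum.cong refl) (subst *, auto)
  also have "R_coeff h 0 * (1 / y\<^sup>2) + \<dots> = (\<Sum>k\<le>2*h. R_coeff h k / (y\<^sup>2 - (real k)\<^sup>2))"
    by (simp add: atMost_atLeast0 sum.atLeast_Suc_atMost)
  finally show ?thesis by (simp add: R_fun_partial_fractions[OF assms])
qed

text \<open>The trigamma values along y + i are tails of one convergent series. Together with the
  difference equation the limit excludes a periodic term.\<close>

lemma Z_fun_tendsto_0:
  fixes y :: real
  assumes "y > 0"
  shows "(\<lambda>i. Z_fun h (y + real i)) \<longlonglongrightarrow> 0"
proof -
  have "summable (\<lambda>k. inverse ((y + real k)\<^sup>2))"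
    using Polygamma_converges'[of y 2] assms by auto
  hence "(\<lambda>i. \<Sum>k. inverse ((y + real (k + i))\<^sup>2)) \<longlonglongrightarrow> 0"
    by (rule suminf_exist_split2)
  hence 1: "(\<lambda>i. Polygamma 1 (y + real i)) \<longlonglongrightarrow> 0"
    by (simp add: Polygamma_def add_ac power2_eq_square)
  have 2: "(\<lambda>i. 1 / (y + real i - real k + real j)) \<longlonglongrightarrow> 0" for j k
    by real_asymp
  have "(\<lambda>i. Z_fun h (y + real i)) \<longlonglongrightarrow> of_real (R_coeff h 0) * 0 +
     (\<Sum>k=1..2*h. of_real (R_coeff h k / (2 * real k)) * (\<Sum>j<2*k. 0))"
    unfolding Z_fun_def of_real_eq_id id_apply
    by (intro tendsto_add tendsto_mult tendsto_const tendsto_sum 1 2)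
  thus ?thesis by simp
qed

text \<open>Grouping the Basel series in pairs splits off the even terms, which make up a quarter of
  the whole: pi^2/6 - pi^2/24.\<close>

lemma sums_odd_inverse_squares: "(\<lambda>k. 1 / (real (2 * k + 1))\<^sup>2) sums (pi\<^sup>2 / 8)"
proof -
  have 1: "(\<lambda>n. 1 / (real n + 1)\<^sup>2) sums (pi\<^sup>2 / 6)"
    using inverse_squares_sums by (simp add: add.commute)
  have "(\<lambda>n. \<Sum>i = n * 2..<n * 2 + 2. 1 / (real i + 1)\<^sup>2) sums (pi\<^sup>2 / 6)"
    by (rule sums_group[OF 1]) auto
  moreover have "(\<Sum>i = n * 2..<n * 2 + 2. 1 / (real i + 1)\<^sup>2) =
      1 / (real (2 * n + 1))\<^sup>2 + 1 / 4 * (1 / (real n + 1)\<^sup>2)" for n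
  proof -
    have "{n * 2..<n * 2 + 2} = {2 * n, 2 * n + 1}" by auto
    moreover have "(real (2 * n + 1) + 1)\<^sup>2 = 4 * (real n + 1)\<^sup>2"
      by (simp add: power2_eq_square algebra_simps)
    ultimately show ?thesis by (simp add: add.commute)
  qed
  ultimately have "(\<lambda>n. 1 / (real (2 * n + 1))\<^sup>2 + 1 / 4 * (1 / (real n + 1)\<^sup>2)) sums (pi\<^sup>2 / 6)"
    by simp
  from sums_diff[OF this sums_mult[OF 1, of "1 / 4"]] show ?thesis by simp
qed

lemma Polygamma_1_one_half: "Polygamma 1 (1 / 2 :: real) = pi\<^sup>2 / 2"
proof -
  have "(\<lambda>k. 4 * (1 / (real (2 * k + 1))\<^sup>2)) sums (4 * (pi\<^sup>2 / 8))"
    by (intro sums_mult sums_odd_inverse_squares)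
  also have "(\<lambda>k. 4 * (1 / (real (2 * k + 1))\<^sup>2)) = (\<lambda>k. inverse ((1 / 2 + real k) ^ Suc 1))"
    by (auto simp: fun_eq_iff field_simps power2_eq_square)
  finally show ?thesis by (simp add: Polygamma_def sums_iff)
qed

text \<open>The 2k denominators are the half-integers from 1/2 - k to k - 1/2, symmetric about 0, so
  the simple fractions cancel in pairs.\<close>

lemma Z_fun_one_half: "Z_fun h (1 / 2 :: real) = R_coeff h 0 * (pi\<^sup>2 / 2)"
proof -
  have "(\<Sum>j<2*k. 1 / (1 / 2 - real k + real j)) = 0" for k
  proof -
    have "(\<Sum>j<2*k. 1 / (1 / 2 - real k + real j)) = (\<Sum>j<2*k. 1 / (1 / 2 - real k + real (2 * k - Suc j)))"
      by (rule sum.nat_diff_reindex[symmetric])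
    also have "\<dots> = (\<Sum>j<2*k. - (1 / (1 / 2 - real k + real j)))"
    proof (intro sum.cong refl)
      fix j assume "j \<in> {..<2*k}"
      hence "real (2 * k - Suc j) = 2 * real k - 1 - real j" by (simp add: of_nat_diff)
      hence "1 / 2 - real k + real (2 * k - Suc j) = - (1 / 2 - real k + real j)" by simp
      thus "1 / (1 / 2 - real k + real (2 * k - Suc j)) = - (1 / (1 / 2 - real k + real j))"
        by (metis divide_minus_right)
    qed
    finally show ?thesis by (simp add: sum_negf)
  qed
  thus ?thesis by (simp add: Z_fun_def Polygamma_1_one_half del: One_nat_def)
qed

text \<open>For h > 0 the numerator of R contains y^2 - 1/4, so R vanishes at -1/2 and the
  difference equation gives equal values at -1/2 and 1/2.\<close>

lemma Z_fun_minus_one_half: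
  assumes "h > 0"
  shows "Z_fun h (- 1 / 2 :: real) = R_coeff h 0 * (pi\<^sup>2 / 2)"
proof -
  have "(- 1 / 2 :: real)\<^sup>2 \<noteq> (real k)\<^sup>2" for k
  proof
    assume "(- 1 / 2 :: real)\<^sup>2 = (real k)\<^sup>2"
    hence "(2 * real k)\<^sup>2 = 1\<^sup>2" by (simp add: power2_eq_square)
    hence "real (2 * k) = 1" by (subst (asm) power2_eq_iff) auto
    hence "2 * k = 1" by linarith
    thus False by presburger
  qed
  hence "Z_fun h (- 1 / 2 :: real) - Z_fun h (- 1 / 2 + 1 :: real) = R_fun h (- 1 / 2)"
    by (intro Z_fun_step)
  moreover have "R_fun h (- 1 / 2) = 0"
    unfolding R_fun_def using assms by (auto intro!: bexI[of _ 0] simp: power2_eq_square)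
  ultimately show ?thesis using Z_fun_one_half[of h] by simp
qed

section \<open>Gamma quotients as centred products, and the closed form of I_1\<close>

text \<open>The factors lie symmetrically around y at half-integer distances; opposite ones multiply
  to a difference of squares.\<close>

lemma pochhammer_centred_odd:
  fixes y :: "'a :: field_char_0"
  shows "pochhammer (y - of_nat h + 1 / 2) (2 * h) = (\<Prod>j<h. y\<^sup>2 - (of_nat j + 1 / 2)\<^sup>2)"
proof (induction h)
  case (Suc h)
  have "pochhammer (y - of_nat (Suc h) + 1 / 2) (2 * Suc h) =
        (y - of_nat h - 1 / 2) * pochhammer (y - of_nat h + 1 / 2) (Suc (2 * h))"
    using pochhammer_rec[of "y - of_nat (Suc h) + 1 / 2" "Suc (2 * h)"] by (simp add: algebra_simps)
  also have "\<dots> = (y - of_nat h - 1 / 2) * (y + of_nat h + 1 / 2) * pochhammer (y - of_nat h + 1 / 2) (2 * h)"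
  proof -
    have "y - of_nat h + 1 / 2 + of_nat (2 * h) = y + of_nat h + 1 / 2" by simp
    thus ?thesis by (simp only: pochhammer_Suc mult_ac)
  qed
  also have "(y - of_nat h - 1 / 2) * (y + of_nat h + 1 / 2) = y\<^sup>2 - (of_nat h + 1 / 2)\<^sup>2"
    by (simp add: power2_eq_square algebra_simps)
  finally show ?case using Suc.IH by simp
qed auto

text \<open>With integer distances the middle factor y has no partner; the additional y on the left
  supplies it.\<close>

lemma pochhammer_centred_even:
  fixes y :: "'a :: field_char_0"
  shows "y * pochhammer (y - of_nat m) (2 * m + 1) = (\<Prod>k\<le>m. y\<^sup>2 - (of_nat k)\<^sup>2)"
proof (induction m)
  case (Suc m)
  have "pochhammer (y - of_nat (Suc m)) (2 * Suc m + 1) =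
        (y - of_nat m - 1) * pochhammer (y - of_nat m) (Suc (2 * m + 1))"
    using pochhammer_rec[of "y - of_nat (Suc m)" "Suc (2 * m + 1)"] by (simp add: algebra_simps)
  also have "\<dots> = (y - of_nat m - 1) * (y + of_nat m + 1) * pochhammer (y - of_nat m) (2 * m + 1)"
    by (subst pochhammer_Suc) (simp add: algebra_simps)
  also have "(y - of_nat m - 1) * (y + of_nat m + 1) = y\<^sup>2 - (of_nat (Suc m))\<^sup>2"
    by (simp add: power2_eq_square algebra_simps)
  finally show ?case using Suc.IH by simp
qed (auto simp: power2_eq_square)

lemma half_odd_not_Ints: "real h + 1 / 2 \<notin> \<int>"
proof
  assume "real h + 1 / 2 \<in> \<int>"
  then obtain k where "real h + 1 / 2 = of_int k" by (elim Ints_cases)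
  hence "real_of_int (2 * int h + 1) = real_of_int (2 * k)" by simp
  hence "2 * int h + 1 = 2 * k" by linarith
  thus False by presburger
qed

lemma I_integral_eq_S_moment:
  fixes n :: nat
  defines "v \<equiv> real n / 2"
  assumes v: "v > 1 / 2" "v \<notin> \<int>" and s: "s > -1"
  shows "I_integral n m s = Gamma (v + s + 1) / (Gamma v * Gamma (s + 1)) * S_moment v m s"
proof -
  have "(LINT t:{0<..<1}|lborel. t powr (real m + v - 1) * (1 - t) powr s * (S_fun n m t)\<^sup>2) =
        (LINT t:{0<..<1}|lborel. t powr (real m + v - 1) * (1 - t) powr s * (S_ser v m t)\<^sup>2)"
    using S_fun_eq_eval_fps[of n _ m] v
    by (intro set_lebesgue_integral_cong) (auto simp: v_def S_ser_def)
  also have "\<dots> = S_moment v m s"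
    unfolding S_moment_def using v s
    by (intro LINT_eq_beta_integral continuous_intros continuous_on_S_ser) auto
  finally show ?thesis by (simp add: I_integral_def v_def)
qed

lemma Gamma_neq_0: "(x :: real) > 0 \<Longrightarrow> Gamma x \<noteq> 0"
  by (metis Gamma_real_pos less_irrefl)

lemma I_integral_0:
  assumes "real n / 2 > 1 / 2" "real n / 2 \<notin> \<int>" and s: "s > -1"
  shows "I_integral n 0 s = 1"
proof -
  have "Gamma (real n / 2) \<noteq> 0" "Gamma (s + 1) \<noteq> 0" "Gamma (real n / 2 + s + 1) \<noteq> 0"
    using assms by (auto intro!: Gamma_neq_0)
  thus ?thesis unfolding I_integral_eq_S_moment[OF assms] S_moment_def using assms
    by (simp add: beta_integral_one Beta_def add_ac)
qed

text \<open>The Gamma quotients have integer gaps 2h and 4h + 1, and both products are centred at s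
  + n. For odd n the first runs over half-integer offsets, which makes the inhomogeneity of the
  recurrence in s an even rational function.\<close>

lemma R_fun_eq_Gamma:
  fixes s :: real and h :: nat
  assumes s: "s > -1"
  defines "v \<equiv> real h + 1 / 2"
  shows "R_fun h (s + 2 * v) =
    Gamma (s + 1) * Gamma (s + 3 * v) / ((s + 2 * v) * Gamma (v + s + 1) * Gamma (s + 4 * v))"
proof -
  define y where "y = s + 2 * v"
  have "pochhammer (s + v + 1) (2 * h) = Gamma (s + v + 1 + real (2 * h)) / Gamma (s + v + 1)"
    using s by (intro pochhammer_Gamma) (auto simp: v_def elim!: nonpos_Ints_cases)
  also have "s + v + 1 + real (2 * h) = s + 3 * v" by (simp add: v_def)
  finally have 1: "(\<Prod>j<h. y\<^sup>2 - (real j + 1 / 2)\<^sup>2) = Gamma (s + 3 * v) / Gamma (v + s + 1)"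
    using pochhammer_centred_odd[of y h] by (simp add: y_def v_def add_ac)
  have "pochhammer (s + 1) (4 * h + 1) = Gamma (s + 1 + real (4 * h + 1)) / Gamma (s + 1)"
    using s by (intro pochhammer_Gamma) (auto simp: v_def elim!: nonpos_Ints_cases)
  also have "s + 1 + real (4 * h + 1) = s + 4 * v" by (simp add: v_def)
  finally have 2: "(\<Prod>k\<le>2*h. y\<^sup>2 - (real k)\<^sup>2) = y * (Gamma (s + 4 * v) / Gamma (s + 1))"
    using pochhammer_centred_even[of y "2 * h"] by (simp add: y_def v_def add_ac)
  show ?thesis unfolding y_def[symmetric] R_fun_def 1 2 by (simp add: mult_ac)
qed

lemma tendsto_0_periodic_imp_0:
  fixes d :: "nat \<Rightarrow> real"
  assumes "d \<longlonglongrightarrow> 0" "\<And>i. d (Suc i) = d i"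
  shows "d 0 = 0"
proof -
  have "d i = d 0" for i using assms(2) by (induction i) auto
  thus ?thesis using assms(1) LIMSEQ_unique[of "\<lambda>_. d 0" "d 0" 0] by (metis ext tendsto_const)
qed

text \<open>The summation factor \<open>u\<close> turns the recurrence in s into a difference
  equation with right side proportional to R, which \<open>Z_fun\<close> solves up to the same
  constant. The difference \<open>d\<close> of the two solutions along s + i is constant in i and
  tends to 0.\<close>

lemma S_moment_1_eq:
  fixes h :: nat
  defines "v \<equiv> real h + 1 / 2"
  assumes h: "h > 0" and s: "s > -1"
  shows "S_moment v 1 s * (Gamma (s + 3 * v) / Gamma (s + 4 * v - 1)) =
           2 * (2 * v - 1)\<^sup>2 * Gamma v * Z_fun h (s + 2 * v)"
proof -
  have v: "v > 1 / 2" "v \<notin> \<int>" "v \<ge> 1"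
    using h half_odd_not_Ints[of h] by (auto simp: v_def)
  define u where "u = (\<lambda>s. Gamma (s + 3 * v) / Gamma (s + 4 * v - 1))"
  define d where "d = (\<lambda>i::nat. S_moment v 1 (s + i) * u (s + i) - 2 * (2 * v - 1)\<^sup>2 * Gamma v * Z_fun h (s + i + 2 * v))"
  have u_step: "u (x + 1) = u x * ((x + 3 * v) / (x + 4 * v - 1))" if x: "x > -1" for x
  proof -
    have "Gamma (x + 3 * v + 1) = (x + 3 * v) * Gamma (x + 3 * v)"
         "Gamma (x + 4 * v - 1 + 1) = (x + 4 * v - 1) * Gamma (x + 4 * v - 1)"
      using x v by (intro Gamma_plus1; auto elim!: nonpos_Ints_cases)+
    thus ?thesis by (simp add: u_def algebra_simps)
  qed
  have u_nonneg: "u x \<ge> 0" if "x > -1" for x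
    unfolding u_def using that v by (intro divide_nonneg_nonneg less_imp_le[OF Gamma_real_pos]) auto
  have u_le: "u (s + i) \<le> u s" for i :: nat
  proof (induction i)
    case (Suc i)
    \<comment> \<open>This is where v >= 1 enters: 3v <= 4v - 1, so \<open>u\<close> does not grow
      along the shifts.\<close>
    have "(s + i + 3 * v) / (s + i + 4 * v - 1) \<le> 1"
      using s v by (subst divide_le_eq_1_pos) auto
    hence "u (s + i) * ((s + i + 3 * v) / (s + i + 4 * v - 1)) \<le> u (s + i) * 1"
      using s u_nonneg[of "s + i"] by (intro mult_left_mono) auto
    hence "u (s + i + 1) \<le> u (s + i) * 1"
      using s u_step[of "s + i"] by simp
    thus ?case using Suc.IH by (simp add: add_ac)
  qed auto
  obtain C where C: "\<And>s. s > -1 \<Longrightarrow> \<bar>S_moment v 1 s\<bar> \<le> C / (s + 1)"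
    using S_moment_1_bound[OF v(1,2)] by blast
  have "(\<lambda>i::nat. S_moment v 1 (s + i) * u (s + i)) \<longlonglongrightarrow> 0"
  proof (rule Lim_null_comparison)
    show "\<forall>\<^sub>F i :: nat in sequentially. norm (S_moment v 1 (s + i) * u (s + i)) \<le> C / (s + i + 1) * u s"
    proof (intro always_eventually allI)
      fix i :: nat
      have "norm (S_moment v 1 (s + i) * u (s + i)) = \<bar>S_moment v 1 (s + i)\<bar> * u (s + i)"
        using u_nonneg[of "s + i"] s by (simp add: abs_mult)
      also have "\<dots> \<le> C / (s + i + 1) * u s"
        using s C[of "s + i"] u_le[of i] u_nonneg[of "s + i"]
        by (intro mult_mono) (auto intro: order_trans[OF abs_ge_zero])
      finally show "norm (S_moment v 1 (s + i) * u (s + i)) \<le> C / (s + i + 1) * u s" .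
    qed
    show "(\<lambda>i::nat. C / (s + i + 1) * u s) \<longlonglongrightarrow> 0" by real_asymp
  qed
  moreover have "(\<lambda>i::nat. Z_fun h (s + i + 2 * v)) \<longlonglongrightarrow> 0"
    using Z_fun_tendsto_0[of "s + 2 * v" h] s v by (simp add: add_ac)
  ultimately have "d \<longlonglongrightarrow> 0 - 2 * (2 * v - 1)\<^sup>2 * Gamma v * 0"
    unfolding d_def by (intro tendsto_diff tendsto_mult tendsto_const)
  moreover have "d (Suc i) = d i" for i
  proof -
    define x where "x = s + i"
    have x: "x > -1" using s by (simp add: x_def)
    have "Z_fun h (x + 2 * v) - Z_fun h (x + 2 * v + 1) = R_fun h (x + 2 * v)"
    proof (rule Z_fun_step)
      fix k assume "k \<le> 2 * h"
      hence "x + 2 * v > real k" using x by (simp add: v_def)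
      thus "(x + 2 * v)\<^sup>2 \<noteq> (real k)\<^sup>2" using x by (subst power2_eq_iff_nonneg) auto
    qed
    hence Z: "Z_fun h (x + 2 * v + 1) = Z_fun h (x + 2 * v) - R_fun h (x + 2 * v)" by simp
    have nz: "x + 2 * v \<noteq> 0" "x + 4 * v - 1 \<noteq> 0" "Gamma (x + 4 * v - 1) \<noteq> 0"
      using x v by (auto intro!: Gamma_neq_0)
    have "Gamma (x + 4 * v - 1 + 1) = (x + 4 * v - 1) * Gamma (x + 4 * v - 1)"
      using x v by (intro Gamma_plus1) (auto elim!: nonpos_Ints_cases)
    hence G: "Gamma (x + 4 * v) = (x + 4 * v - 1) * Gamma (x + 4 * v - 1)" by simp
    have "S_moment v 1 (x + 1) * u (x + 1) =
      ((v + x + 2 * v) * S_moment v 1 (x + 1)) * (u x / (x + 4 * v - 1))"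
    proof -
      have "v + x + 2 * v = x + 3 * v" by simp
      thus ?thesis unfolding u_step[OF x] by (simp only: times_divide_eq_left times_divide_eq_right mult_ac)
    qed
    also have "(v + x + 2 * v) * S_moment v 1 (x + 1) =
        (x + 4 * v - 1) * S_moment v 1 x - 2 * (2 * v - 1)\<^sup>2 / (x + 2 * v) * Beta v (x + 1)"
      using S_moment_1_step[OF v(1,2) x] by simp
    also have "\<dots> * (u x / (x + 4 * v - 1)) = S_moment v 1 x * u x
        - 2 * (2 * v - 1)\<^sup>2 / (x + 2 * v) * Beta v (x + 1) * (u x / (x + 4 * v - 1))"
    proof -
      have "(D * J - B) * (U / D) = J * U - B * (U / D)" if "D \<noteq> 0" for D J B U :: real
        using that by (simp add: field_simps)
      thus ?thesis using nz(2) .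
    qed
    also have "2 * (2 * v - 1)\<^sup>2 / (x + 2 * v) * Beta v (x + 1) * (u x / (x + 4 * v - 1)) =
        2 * (2 * v - 1)\<^sup>2 * Gamma v * R_fun h (x + 2 * v)"
    proof -
      have R: "R_fun h (x + 2 * v) =
          Gamma (x + 1) * Gamma (x + 3 * v) / ((x + 2 * v) * Gamma (v + x + 1) * Gamma (x + 4 * v))"
        unfolding v_def by (rule R_fun_eq_Gamma[OF x])
      show ?thesis
        unfolding R u_def Beta_def G using nz by (simp add: add_ac mult_ac)
    qed
    finally have S_step: "S_moment v 1 (x + 1) * u (x + 1) = S_moment v 1 x * u x - 2 * (2 * v - 1)\<^sup>2 * Gamma v * R_fun h (x + 2 * v)" .
    have "S_moment v 1 (x + 1) * u (x + 1) - 2 * (2 * v - 1)\<^sup>2 * Gamma v * Z_fun h (x + 1 + 2 * v) =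
           S_moment v 1 x * u x - 2 * (2 * v - 1)\<^sup>2 * Gamma v * Z_fun h (x + 2 * v)"
    proof -
      have "x + 1 + 2 * v = x + 2 * v + 1" by simp
      thus ?thesis by (simp only: S_step Z right_diff_distrib)
    qed
    thus ?thesis by (simp add: d_def x_def add_ac)
  qed
  ultimately have "d 0 = 0" by (intro tendsto_0_periodic_imp_0) auto
  thus ?thesis by (simp add: d_def u_def)
qed

text \<open>The Gamma factors combine to quotients with integer gaps 4h and 2h. What remains is a
  rational function of s times \<open>Z_fun\<close>, which makes sense for complex s.\<close>

lemma I_integral_1:
  fixes n h :: nat
  assumes n: "n = 2 * h + 1" and h: "h > 0" and s: "s > -1"
  shows "I_integral n 1 s = 2 * (2 * real h)\<^sup>2 *
     (pochhammer (s + 1) (4 * h) / pochhammer (s + real n / 2 + 1) (2 * h)) * Z_fun h (s + n)"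
proof -
  define v where "v = real h + 1 / 2"
  have v: "v > 1 / 2" "v \<notin> \<int>" "v \<ge> 1" "real n / 2 = v"
    using h half_odd_not_Ints[of h] by (auto simp: v_def n)
  have n': "real n = 2 * v" "2 * real h = 2 * v - 1" by (simp_all add: v_def n)
  have "pochhammer (s + v + 1) (2 * h) = Gamma (s + v + 1 + real (2 * h)) / Gamma (s + v + 1)"
    using s by (intro pochhammer_Gamma) (auto simp: v_def elim!: nonpos_Ints_cases)
  also have "s + v + 1 + real (2 * h) = s + 3 * v" by (simp add: v_def)
  finally have 1: "pochhammer (s + v + 1) (2 * h) = Gamma (s + 3 * v) / Gamma (s + v + 1)" .
  have "pochhammer (s + 1) (4 * h) = Gamma (s + 1 + real (4 * h)) / Gamma (s + 1)"
    using s by (intro pochhammer_Gamma) (auto simp: v_def elim!: nonpos_Ints_cases)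
  also have "s + 1 + real (4 * h) = s + 4 * v - 1" by (simp add: v_def)
  finally have 2: "pochhammer (s + 1) (4 * h) = Gamma (s + 4 * v - 1) / Gamma (s + 1)" .
  have nz: "Gamma (s + v + 1) \<noteq> 0" "Gamma v \<noteq> 0" "Gamma (s + 1) \<noteq> 0" "Gamma (s + 3 * v) \<noteq> 0"
    "Gamma (s + 4 * v - 1) \<noteq> 0"
    using s v by (auto intro!: Gamma_neq_0)
  have J: "S_moment v 1 s = 2 * (2 * v - 1)\<^sup>2 * Gamma v * Z_fun h (s + 2 * v) * Gamma (s + 4 * v - 1) / Gamma (s + 3 * v)"
    using S_moment_1_eq[OF h s] nz unfolding v_def[symmetric] by (simp add: field_simps)
  have "I_integral n 1 s = Gamma (v + s + 1) / (Gamma v * Gamma (s + 1)) * S_moment v 1 s"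
    using I_integral_eq_S_moment[of n s 1] v s by simp
  also have "\<dots> = 2 * (2 * v - 1)\<^sup>2 *
     (pochhammer (s + 1) (4 * h) / pochhammer (s + v + 1) (2 * h)) * Z_fun h (s + 2 * v)"
    unfolding J 1 2 using nz by (simp add: add_ac mult_ac)
  finally show ?thesis by (simp only: v(4) n'(2) n'(1)[symmetric])
qed

lemma I_integral_rec:
  fixes n j :: nat and s v m \<sigma> :: real
  defines "v \<equiv> real n / 2" and "m \<equiv> real j + 1" and "\<sigma> \<equiv> s + n"
  assumes v: "v > 1 / 2" "v \<notin> \<int>" and s: "s > -1"
  shows "m\<^sup>2 * (m - 1 + v + \<sigma>) * I_integral n (Suc (Suc j)) s =
     2 * (m - 1 + v) * (m\<^sup>2 + (real n - 2) * m + 1 - v + \<sigma> * (1 - \<sigma>) / 2) * I_integral n (Suc j) s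
     - (m + n - 2)\<^sup>2 * (m - 1 + v - \<sigma>) * I_integral n j s"
proof -
  define G where "G = Gamma (v + s + 1) / (Gamma v * Gamma (s + 1))"
  have I: "I_integral n k s = G * S_moment v k s" for k
    using I_integral_eq_S_moment[of n s k] v s by (simp add: G_def v_def)
  have n: "real n = 2 * v" by (simp add: v_def)
  have "m\<^sup>2 * (m - 1 + v + \<sigma>) * S_moment v (Suc (Suc j)) s =
     2 * (m - 1 + v) * (m\<^sup>2 + (real n - 2) * m + 1 - v + \<sigma> * (1 - \<sigma>) / 2) * S_moment v (Suc j) s
     - (m + n - 2)\<^sup>2 * (m - 1 + v - \<sigma>) * S_moment v j s"
    using S_moment_rec[OF v s, of j] unfolding m_def \<sigma>_def n by (simp add: algebra_simps)
  from arg_cong[OF this, of "\<lambda>x. G * x"] show ?thesis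
    unfolding I by (simp add: algebra_simps)
qed

section \<open>Convolution form of the terminating sums\<close>

text \<open>Coefficient of x^l in 3F2(1 - \<sigma>, v, 2v - \<sigma>; v + 1 - \<sigma>, 2v;
  x).\<close>

definition conv_coeff :: "real \<Rightarrow> real \<Rightarrow> nat \<Rightarrow> real" where
  "conv_coeff v \<sigma> l = pochhammer (1 - \<sigma>) l * pochhammer v l * pochhammer (2 * v - \<sigma>) l /
     (pochhammer (v + 1 - \<sigma>) l * pochhammer (2 * v) l * fact l)"

text \<open>Coefficient of x^k in (1 - x)^(-\<sigma>).\<close>

definition binom_coeff :: "real \<Rightarrow> nat \<Rightarrow> real" where
  "binom_coeff \<sigma> k = pochhammer \<sigma> k / fact k"

text \<open>The coefficient of x^(m-1) in the product of the two series. The shift makes m = 0 an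
  empty sum, matching the residue 0 of I_0.\<close>

definition conv_sum :: "real \<Rightarrow> real \<Rightarrow> nat \<Rightarrow> real" where
  "conv_sum v \<sigma> m = (\<Sum>l<m. conv_coeff v \<sigma> l * binom_coeff \<sigma> (m - 1 - l))"

lemma binom_coeff_Suc: "binom_coeff \<sigma> (Suc k) * (k + 1) = binom_coeff \<sigma> k * (\<sigma> + k)"
  by (simp add: binom_coeff_def pochhammer_Suc)

lemma binom_coeff_minus_1: "binom_coeff (\<sigma> - 1) (Suc k) * (k + 1) = (\<sigma> - 1) * binom_coeff \<sigma> k"
  using pochhammer_rec[of "\<sigma> - 1" k] by (simp add: binom_coeff_def)

lemma conv_coeff_Suc:
  assumes "v > 0" "\<sigma> < v + 1"
  shows "conv_coeff v \<sigma> (Suc l) * ((v + 1 - \<sigma> + l) * (2 * v + l) * (l + 1)) =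
    conv_coeff v \<sigma> l * ((1 - \<sigma> + l) * (v + l) * (2 * v - \<sigma> + l))"
proof -
  have "v + 1 - \<sigma> + l > 0" "2 * v + l > 0" using assms by auto
  thus ?thesis by (simp add: conv_coeff_def pochhammer_Suc mult_ac)
qed

text \<open>
  The summand of \<^const>\<open>conv_sum\<close> satisfies the three-term recurrence up to the telescoping
  differences of \<open>- conv_coeff v \<sigma> l * l * (v - \<sigma> + l) * (2 * v - 1 + l) * binom_coeff (\<sigma> - 1) (m + 1 - l)\<close>,
  a certificate of Zeilberger's algorithm.
\<close>
lemma conv_sum_rec:
  assumes "v > 0" "\<sigma> < v + 1"
  shows "real (m + 1) * (m + 2 * v) * (m + v + 1 - \<sigma>) * conv_sum v \<sigma> (Suc (Suc m))
       - (2 * real m + 2 * v) * ((real m)\<^sup>2 + 2 * v * m + v + \<sigma> * (1 - \<sigma>) / 2) * conv_sum v \<sigma> (Suc m)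
       + m * (m + 2 * v - 1) * (m + v + \<sigma> - 1) * conv_sum v \<sigma> m = 0"
proof -
  define a where "a = conv_coeff v \<sigma>"
  define p where "p = binom_coeff \<sigma>"
  define q where "q = binom_coeff (\<sigma> - 1)"
  define P2 where "P2 = real (m + 1) * (m + 2 * v) * (m + v + 1 - \<sigma>)"
  define P1 where "P1 = - ((2 * real m + 2 * v) * ((real m)\<^sup>2 + 2 * v * m + v + \<sigma> * (1 - \<sigma>) / 2))"
  define P0 where "P0 = m * (m + 2 * v - 1) * (m + v + \<sigma> - 1)"
  define \<alpha> where "\<alpha> = (\<lambda>l::nat. a l * (real l * (v - \<sigma> + l) * (2 * v - 1 + l)))"
  define V where "V = (\<lambda>l. - \<alpha> l * q (m + 1 - l))"
  have \<alpha>: "\<alpha> (Suc l) = a l * ((1 - \<sigma> + l) * (v + l) * (2 * v - \<sigma> + l))" for l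
    using conv_coeff_Suc[OF assms, of l] by (simp add: \<alpha>_def a_def algebra_simps)
  \<comment> \<open>Here j stands for m - 1 - l. With m = l + j + 1 and the common factor
    \<open>a l * p j\<close> removed, a polynomial identity in l, j, v and \<sigma> remains.\<close>
  have step: "a l * (P0 * p j + P1 * p (Suc j) + P2 * p (Suc (Suc j))) = V (Suc l) - V l"
    if "m = l + j + 1" for l j
  proof -
    have "real m = real l + real j + 1" using that by simp
    have p1: "p (Suc j) = p j * (\<sigma> + j) / (real j + 1)"
      using binom_coeff_Suc[of \<sigma> j] by (simp add: p_def field_simps)
    have p2: "p (Suc (Suc j)) = p j * (\<sigma> + j) * (\<sigma> + j + 1) / ((real j + 1) * (real j + 2))"
    proof -
      have "p (Suc (Suc j)) * (real j + 2) = p (Suc j) * (\<sigma> + j + 1)"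
        using binom_coeff_Suc[of \<sigma> "Suc j"] by (simp add: p_def add_ac)
      hence "p (Suc (Suc j)) = p (Suc j) * (\<sigma> + j + 1) / (real j + 2)"
        by (intro eq_divide_imp) auto
      thus ?thesis unfolding p1 by (simp add: add.commute)
    qed
    have q1: "q (Suc j) = (\<sigma> - 1) * p j / (real j + 1)"
      using binom_coeff_minus_1[of \<sigma> j] by (simp add: p_def q_def field_simps)
    have q2: "q (Suc (Suc j)) = (\<sigma> - 1) * p j * (\<sigma> + j) / ((real j + 1) * (real j + 2))"
    proof -
      have "q (Suc (Suc j)) * (real j + 2) = (\<sigma> - 1) * p (Suc j)"
        using binom_coeff_minus_1[of \<sigma> "Suc j"] by (simp add: p_def q_def add_ac)
      hence "q (Suc (Suc j)) = (\<sigma> - 1) * p (Suc j) / (real j + 2)"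
        by (intro eq_divide_imp) auto
      thus ?thesis unfolding p1 by (simp add: add.commute)
    qed
    have V1: "V (Suc l) = - \<alpha> (Suc l) * q (Suc j)" and V0: "V l = - \<alpha> l * q (Suc (Suc j))"
      using that by (simp_all add: V_def)
    have key: "P0 * ((real j + 1) * (real j + 2)) + P1 * ((\<sigma> + j) * (real j + 2)) + P2 * ((\<sigma> + j) * (\<sigma> + j + 1)) =
      - ((1 - \<sigma> + l) * (v + l) * (2 * v - \<sigma> + l)) * ((\<sigma> - 1) * (real j + 2))
      + (real l * (v - \<sigma> + l) * (2 * v - 1 + l)) * ((\<sigma> - 1) * (\<sigma> + j))"
      unfolding P0_def P1_def P2_def that of_nat_add of_nat_1
      by (simp add: field_simps power2_eq_square)
    have "a l * (P0 * p j + P1 * p (Suc j) + P2 * p (Suc (Suc j))) =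
      a l * p j * (P0 * ((real j + 1) * (real j + 2)) + P1 * ((\<sigma> + j) * (real j + 2)) + P2 * ((\<sigma> + j) * (\<sigma> + j + 1)))
        / ((real j + 1) * (real j + 2))"
      unfolding p1 p2 by (simp add: divide_simps) (simp add: algebra_simps)
    also have "\<dots> = V (Suc l) - V l"
    proof -
      have "A * B * (- X * ((\<sigma> - 1) * z) + Y * ((\<sigma> - 1) * w)) / (x * z) =
          - (A * X) * ((\<sigma> - 1) * B / x) - - (A * Y) * ((\<sigma> - 1) * B * w / (x * z))"
        if "x > 0" "z > 0" for A B X Y x z w :: real
        using that by (simp add: divide_simps) (simp add: algebra_simps)
      note gen = this
      show ?thesis unfolding key V1 V0 \<alpha> q1 q2 unfolding \<alpha>_def by (rule gen) auto
    qed
    finally show ?thesis .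
  qed
  \<comment> \<open>The term l = m is absent from the shortest of the three sums, and l = m + 1
    occurs only in the longest; both are matched with the certificate separately.\<close>
  have step0: "a m * (P1 * p 0 + P2 * p 1) = V (Suc m) - V m"
  proof -
    have p: "p 0 = 1" "p 1 = \<sigma>" "q 0 = 1" "q 1 = \<sigma> - 1"
      by (simp_all add: p_def q_def binom_coeff_def)
    have V1: "V (Suc m) = - \<alpha> (Suc m)" and V0: "V m = - \<alpha> m * (\<sigma> - 1)"
      using p by (simp_all add: V_def)
    have "P1 + P2 * \<sigma> = - ((1 - \<sigma> + m) * (v + m) * (2 * v - \<sigma> + m))
      + (real m * (v - \<sigma> + m) * (2 * v - 1 + m)) * (\<sigma> - 1)"
      unfolding P1_def P2_def by (simp add: field_simps power2_eq_square)
    hence "a m * (P1 * p 0 + P2 * p 1) = a m * (- ((1 - \<sigma> + m) * (v + m) * (2 * v - \<sigma> + m))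
      + (real m * (v - \<sigma> + m) * (2 * v - 1 + m)) * (\<sigma> - 1))"
      unfolding p by simp
    thus ?thesis unfolding V1 V0 \<alpha> by (simp add: \<alpha>_def algebra_simps)
  qed
  have last: "a (Suc m) * (P2 * p 0) = - V (Suc m)"
    by (simp add: V_def \<alpha>_def p_def q_def binom_coeff_def P2_def algebra_simps)
  have D2: "conv_sum v \<sigma> (Suc (Suc m)) = (\<Sum>l<m. a l * p (Suc (Suc (m - 1 - l)))) + a m * p 1 + a (Suc m) * p 0"
    unfolding conv_sum_def a_def p_def by (auto intro!: sum.cong arg_cong[of _ _ "binom_coeff \<sigma>"])
  have D1: "conv_sum v \<sigma> (Suc m) = (\<Sum>l<m. a l * p (Suc (m - 1 - l))) + a m * p 0"
    unfolding conv_sum_def a_def p_def by (auto intro!: sum.cong arg_cong[of _ _ "binom_coeff \<sigma>"])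
  have "P2 * conv_sum v \<sigma> (Suc (Suc m)) + P1 * conv_sum v \<sigma> (Suc m) + P0 * conv_sum v \<sigma> m =
     (\<Sum>l<m. a l * (P0 * p (m - 1 - l) + P1 * p (Suc (m - 1 - l)) + P2 * p (Suc (Suc (m - 1 - l)))))
     + a m * (P1 * p 0 + P2 * p 1) + a (Suc m) * (P2 * p 0)"
    unfolding D2 D1 by (simp add: conv_sum_def a_def[symmetric] p_def[symmetric] sum_distrib_left
        sum.distrib algebra_simps)
  also have "\<dots> = (\<Sum>l<m. V (Suc l) - V l) + (V (Suc m) - V m) - V (Suc m)"
    unfolding step0 last by (subst sum.cong[OF refl step]) auto
  \<comment> \<open>The telescoped sum leaves only \<open>V 0\<close>, which vanishes by its factor
    l.\<close>
  also have "\<dots> = 0"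
    unfolding sum_lessThan_telescope by (simp add: V_def \<alpha>_def)
  finally show ?thesis
    by (simp add: P0_def P1_def P2_def)
qed

lemma conv_sum_0 [simp]: "conv_sum v \<sigma> 0 = 0"
  and conv_sum_1 [simp]: "conv_sum v \<sigma> (Suc 0) = 1"
  by (simp_all add: conv_sum_def conv_coeff_def binom_coeff_def)

section \<open>Signs of the convolution sums\<close>

lemma conv_sum_one_half_nonneg:
  assumes "v > 1 / 4"
  shows "conv_sum v (1 / 2) m \<ge> 0"
  unfolding conv_sum_def conv_coeff_def binom_coeff_def using assms
  by (intro sum_nonneg mult_nonneg_nonneg divide_nonneg_nonneg pochhammer_nonneg) auto

text \<open>On coefficients, (1 - x)^(-\<sigma>) (1 - x)^\<sigma> = 1 is the Vandermonde identity
  for Pochhammer symbols whose parameters add up to 0.\<close>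

lemma sum_binom_coeff_inverse:
  "(\<Sum>l\<le>k. binom_coeff \<sigma> l * binom_coeff (- \<sigma>) (k - l)) = (if k = 0 then 1 else 0)"
proof -
  have "(\<Sum>l\<le>k. binom_coeff \<sigma> l * binom_coeff (- \<sigma>) (k - l)) =
    (\<Sum>l\<le>k. of_nat (k choose l) * pochhammer \<sigma> l * pochhammer (- \<sigma>) (k - l)) / fact k"
    unfolding sum_divide_distrib binom_coeff_def
    by (intro sum.cong refl) (auto simp: binomial_fact field_simps)
  also have "(\<Sum>l\<le>k. of_nat (k choose l) * pochhammer \<sigma> l * pochhammer (- \<sigma>) (k - l)) = pochhammer 0 k"
    using pochhammer_binomial_sum[of \<sigma> "- \<sigma>" k] by simp
  finally show ?thesis by (simp add: pochhammer_0_left)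
qed

lemma binom_coeff_minus_half_neg: "binom_coeff (- 1 / 2) (Suc k) < 0"
proof -
  have "pochhammer (1 / 2 :: real) k > 0" by (intro pochhammer_pos) auto
  thus ?thesis using pochhammer_rec[of "- 1 / 2 :: real" k] by (simp add: binom_coeff_def divide_simps mult_less_0_iff)
qed

text \<open>
  For \<open>\<sigma> = - 1 / 2\<close> the last factor of the convolution is positive only at 0. As the quotient
  of \<^const>\<open>conv_coeff\<close> by the coefficients of \<open>(1 - x) powr (- 1 / 2)\<close> is increasing,
  comparison with \<open>(1 - x) powr (- 1 / 2) * (1 - x) powr (1 / 2) = 1\<close> gives the sign.
\<close>
lemma conv_sum_minus_one_half_nonneg:
  assumes "v \<ge> 1"
  shows "conv_sum v (- 1 / 2) m \<ge> 0"
proof (cases m)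
  case (Suc k)
  define q where "q = (\<lambda>l. conv_coeff v (- 1 / 2) l / binom_coeff (1 / 2) l)"
  have p_pos: "binom_coeff (1 / 2) l > 0" for l
    unfolding binom_coeff_def by (intro divide_pos_pos pochhammer_pos) auto
  have a_pos: "conv_coeff v (- 1 / 2) l > 0" for l
    unfolding conv_coeff_def using assms
    by (intro divide_pos_pos mult_pos_pos pochhammer_pos) auto
  have q_pos: "q l > 0" for l
    unfolding q_def using a_pos p_pos by simp
  have "q l \<le> q (Suc l)" for l
  proof -
    have *: "conv_coeff v (- 1 / 2) (Suc l) = conv_coeff v (- 1 / 2) l *
        ((l + 3 / 2) * (v + l) * (2 * v + 1 / 2 + l)) / ((v + 3 / 2 + l) * (2 * v + l) * (l + 1))"
    proof (rule eq_divide_imp)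
      show "(v + 3 / 2 + l) * (2 * v + l) * (l + 1) \<noteq> 0" using assms by auto
      show "conv_coeff v (- 1 / 2) (Suc l) * ((v + 3 / 2 + l) * (2 * v + l) * (l + 1)) =
        conv_coeff v (- 1 / 2) l * ((l + 3 / 2) * (v + l) * (2 * v + 1 / 2 + l))"
        using conv_coeff_Suc[of v "- 1 / 2" l] assms by (simp add: add_ac)
    qed
    have b: "binom_coeff (1 / 2) (Suc l) = binom_coeff (1 / 2) l * (1 / 2 + l) / (l + 1)"
      using binom_coeff_Suc[of "1 / 2" l] by (simp add: field_simps)
    have "q (Suc l) = q l * (((l + 3 / 2) * (v + l) * (2 * v + 1 / 2 + l)) / ((v + 3 / 2 + l) * (2 * v + l) * (l + 1 / 2)))"
    proof -
      have "A * N / (D * x) / (B * z / x) = A / B * (N / (D * z))"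
        if "D > 0" "B > 0" "x > 0" "z > 0" for A B N D x z :: real
        using that by (simp add: divide_simps)
      from this[of "(v + 3 / 2 + l) * (2 * v + l)" "binom_coeff (1 / 2) l" "real l + 1" "1 / 2 + real l" "conv_coeff v (- 1 / 2) l"
          "(l + 3 / 2) * (v + l) * (2 * v + 1 / 2 + l)"]
      show ?thesis unfolding q_def * b using p_pos[of l] assms by (simp add: add.commute)
    qed
    moreover have "((l + 3 / 2) * (v + l) * (2 * v + 1 / 2 + l)) / ((v + 3 / 2 + l) * (2 * v + l) * (l + 1 / 2)) \<ge> 1"
    proof -
      have "(v + 3 / 2 + l) * (2 * v + l) * (l + 1 / 2) > 0" using assms by (intro mult_pos_pos) auto
      moreover have "((l + 3 / 2) * (v + l) * (2 * v + 1 / 2 + l)) - ((v + 3 / 2 + l) * (2 * v + l) * (l + 1 / 2))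
         = v / 2 * l + 2 * v\<^sup>2 - 3 / 4 * v"
        by (simp add: field_simps power2_eq_square)
      moreover have "v\<^sup>2 \<ge> v * 1" unfolding power2_eq_square using assms by (intro mult_left_mono) auto
      moreover have "v / 2 * l \<ge> 0" using assms by simp
      ultimately have "(v + 3 / 2 + l) * (2 * v + l) * (l + 1 / 2) > 0"
        "(v + 3 / 2 + l) * (2 * v + l) * (l + 1 / 2) \<le> (l + 3 / 2) * (v + l) * (2 * v + 1 / 2 + l)"
        using assms by linarith+
      thus ?thesis by (subst le_divide_eq_1_pos)
    qed
    ultimately show ?thesis using q_pos[of l] by (metis less_imp_le mult.right_neutral mult_left_mono)
  qed
  hence mono: "q i \<le> q j" if "i \<le> j" for i j
    using that by (rule lift_Suc_mono_le)
  show ?thesis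
  proof (cases "k = 0")
    case False
    have eq: "conv_coeff v (- 1 / 2) l = q l * binom_coeff (1 / 2) l" for l
      using p_pos[of l] by (simp add: q_def)
    have "conv_sum v (- 1 / 2) m = (\<Sum>l\<le>k. conv_coeff v (- 1 / 2) l * binom_coeff (- 1 / 2) (k - l))"
      unfolding conv_sum_def Suc by (simp add: lessThan_Suc_atMost)
    \<comment> \<open>Splitting off the constant \<open>q k\<close> isolates the convolution that
      vanishes for k > 0. In what is left, \<open>q l - q k\<close> and the last factor are both
      nonpositive for l < k.\<close>
    also have "\<dots> = (\<Sum>l\<le>k. (q l - q k) * (binom_coeff (1 / 2) l * binom_coeff (- 1 / 2) (k - l)))
        + q k * (\<Sum>l\<le>k. binom_coeff (1 / 2) l * binom_coeff (- 1 / 2) (k - l))"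
      unfolding eq by (simp add: sum_distrib_left sum.distrib[symmetric] algebra_simps)
    also have "\<dots> = (\<Sum>l\<le>k. (q l - q k) * (binom_coeff (1 / 2) l * binom_coeff (- 1 / 2) (k - l)))"
      using False sum_binom_coeff_inverse[of "1 / 2" k] by simp
    also have "\<dots> \<ge> 0"
    proof (intro sum_nonneg)
      fix l assume l: "l \<in> {..k}"
      show "0 \<le> (q l - q k) * (binom_coeff (1 / 2) l * binom_coeff (- 1 / 2) (k - l))"
      proof (cases "l = k")
        case False
        hence "k - l = Suc (k - l - 1)" using l by auto
        hence "binom_coeff (- 1 / 2) (k - l) < 0" by (metis binom_coeff_minus_half_neg)
        thus ?thesis using mono[of l k] l p_pos[of l]
          by (intro mult_nonpos_nonpos mult_nonneg_nonpos) auto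
      qed auto
    qed
    finally show ?thesis .
  qed (simp add: Suc)
qed simp

section \<open>Meromorphic continuation\<close>

text \<open>A shift by a large N moves a neighbourhood of z into the right half-plane, where
  Polygamma is analytic, at the cost of finitely many rational terms. Agreement off their poles
  suffices.\<close>

lemma meromorphic_on_Polygamma_shift:
  "(\<lambda>s::complex. Polygamma k (s + c)) meromorphic_on A"
proof (subst meromorphic_on_meromorphic_at, intro ballI)
  fix z :: complex
  obtain N :: nat where N: "real N > - Re (z + c)"
    using reals_Archimedean2 by blast
  define g where "g = (\<lambda>s. Polygamma k (s + c + of_nat N) - (-1) ^ k * fact k * (\<Sum>j<N. 1 / (s + c + of_nat j) ^ Suc k))"
  have "(\<lambda>s. Polygamma k (s + c + of_nat N)) meromorphic_on {z}"
    using N by (intro analytic_on_imp_meromorphic_on analytic_intros) (auto elim!: nonpos_Ints_cases simp: complex_eq_iff)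
  hence "g meromorphic_on {z}"
    unfolding g_def by (intro meromorphic_intros)
  moreover have "\<forall>\<^sub>F s in at z. Polygamma k (s + c) = g s"
  proof -
    have "\<forall>\<^sub>F s in at z. \<forall>j\<in>{..<N}. s \<noteq> - c - of_nat j"
      by (intro eventually_ball_finite ballI eventually_neq_at_within) auto
    thus ?thesis
    proof eventually_elim
      case (elim s)
      have "s + c \<noteq> - of_nat j" if "j < N" for j
        using elim that by (auto simp: algebra_simps eq_neg_iff_add_eq_0)
      thus ?case
        using Polygamma_plus_of_nat[of N "s + c" k] by (simp add: g_def)
    qed
  qed
  ultimately show "(\<lambda>s. Polygamma k (s + c)) meromorphic_on {z}"
    by (subst meromorphic_on_cong[of "{z}" _ g "{z}"]) auto
qed

text \<open>Identity theorem: the zeros of the difference accumulate at 0. Values at singular points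
  carry no information, so singularities are removed first and the conclusion concerns punctured
  neighbourhoods only.\<close>

lemma meromorphic_eq_on_reals_imp_eventually_eq:
  fixes f g :: "complex \<Rightarrow> complex"
  assumes f: "f meromorphic_on UNIV" and g: "g meromorphic_on UNIV"
    and eq: "\<And>x::real. x > -1 \<Longrightarrow> f (of_real x) = g (of_real x)"
  shows "\<forall>\<^sub>F s in at z. f s = g s"
proof -
  define d where "d = (\<lambda>s. f s - g s)"
  have d: "d meromorphic_on UNIV"
    unfolding d_def by (intro meromorphic_intros f g)
  have ev: "\<forall>\<^sub>F s in at w. remove_sings d s = d s" for w
    by (intro eventually_remove_sings_eq_at meromorphic_on_isolated_singularity
        meromorphic_on_subset[OF d]) auto
  have "\<exists>\<^sub>F s in at 0. d s = 0"
    unfolding frequently_def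
  proof
    assume "\<forall>\<^sub>F s in at 0. \<not> d s = 0"
    then obtain e where e: "e > 0" "\<And>s. s \<noteq> 0 \<Longrightarrow> dist s 0 < e \<Longrightarrow> d s \<noteq> 0"
      by (auto simp: eventually_at)
    have "d (of_real (e / 2)) = 0"
      using e(1) eq[of "e / 2"] by (simp add: d_def)
    thus False using e(2)[of "of_real (e / 2)"] e(1) by auto
  qed
  hence "\<exists>\<^sub>F s in at 0. remove_sings d s = 0"
    using ev[of 0] by (rule frequently_rev_mp[OF _ eventually_mono]) auto
  hence "remove_sings d w = 0" for w
    by (rule frequently_eq_meromorphic_imp_constant[OF _ remove_sings_nicely_meromorphic[OF d]]) auto
  thus ?thesis using ev[of z] by (simp add: d_def eventually_mono)
qed

text \<open>The candidate continuation. In the second equation h + 3/2 is n/2 + 1; the third solves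
  the recurrence at index m = j + 1 for its highest term.\<close>

fun I_cont :: "nat \<Rightarrow> nat \<Rightarrow> complex \<Rightarrow> complex" where
  "I_cont h 0 s = 1"
| "I_cont h (Suc 0) s = 2 * (2 * of_nat h)\<^sup>2 *
     (pochhammer (s + 1) (4 * h) / pochhammer (s + of_nat h + 3 / 2) (2 * h)) * Z_fun h (s + of_nat (2 * h + 1))"
| "I_cont h (Suc (Suc j)) s =
     (let m = of_nat (j + 1); n = of_nat (2 * h + 1); v = n / 2; \<sigma> = s + n
      in (2 * (m - 1 + v) * (m\<^sup>2 + (n - 2) * m + 1 - v + \<sigma> * (1 - \<sigma>) / 2) * I_cont h (Suc j) s
           - (m + n - 2)\<^sup>2 * (m - 1 + v - \<sigma>) * I_cont h j s) / (m\<^sup>2 * (m - 1 + v + \<sigma>)))"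

lemma meromorphic_Z_fun: "(\<lambda>s::complex. Z_fun h (s + c)) meromorphic_on A"
  unfolding Z_fun_def by (intro meromorphic_intros meromorphic_on_Polygamma_shift)

text \<open>The hypothesis avoids all possible poles: those of the trigamma part at nonpositive
  integers, and those of the fractions, which reach up to the integer 2h.\<close>

lemma analytic_Z_fun:
  fixes s :: complex
  assumes "\<And>j::int. j \<ge> - 2 * int h \<Longrightarrow> s + c \<noteq> - of_int j"
  shows "(\<lambda>s::complex. Z_fun h (s + c)) analytic_on {s}"
proof -
  have 1: "s + c - of_nat k + of_nat j \<noteq> 0" if "k \<le> 2 * h" for k j
    using assms[of "int j - int k"] that by (simp add: algebra_simps eq_neg_iff_add_eq_0)
  have "s + c \<notin> \<int>\<^sub>\<le>\<^sub>0"
  proof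
    assume "s + c \<in> \<int>\<^sub>\<le>\<^sub>0"
    then obtain k where "k \<le> 0" "s + c = of_int k" by (elim nonpos_Ints_cases)
    thus False using assms[of "- k"] by simp
  qed
  thus ?thesis
    unfolding Z_fun_def using 1 by (intro analytic_intros) auto
qed

lemma meromorphic_I_cont: "I_cont h m meromorphic_on A"
proof (induction m rule: induct_nat_012)
  case 0
  have e: "I_cont h 0 = (\<lambda>_. 1)" by (simp add: fun_eq_iff)
  show ?case unfolding e by (rule meromorphic_on_const)
next
  case 1
  show ?case
    unfolding I_cont.simps(2)[abs_def] pochhammer_prod
    by (intro meromorphic_intros meromorphic_Z_fun)
next
  case (ge2 j)
  show ?case
    unfolding I_cont.simps(3)[abs_def] Let_def
    by (intro meromorphic_intros ge2)
qed

text \<open>For real s > -1 all denominators are positive and the argument of \<open>Z_fun\<close>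
  exceeds 2h. Hence removing singularities does not change the values there.\<close>

lemma analytic_I_cont:
  fixes x :: real
  assumes "x > -1"
  shows "I_cont h m analytic_on {complex_of_real x}"
proof (induction m rule: induct_nat_012)
  case 0
  have "I_cont h 0 = (\<lambda>_. 1)" by (simp add: fun_eq_iff)
  thus ?case by simp
next
  case 1
  have "(\<lambda>s::complex. Z_fun h (s + of_nat (2 * h + 1))) analytic_on {of_real x}"
  proof (rule analytic_Z_fun)
    fix j :: int assume "j \<ge> - 2 * int h"
    hence "real_of_int (- 2 * int h) \<le> real_of_int j"
      by (simp only: of_int_le_iff)
    hence "x + real (2 * h + 1) > - real_of_int j"
      using assms by simp
    hence "complex_of_real (x + real (2 * h + 1)) \<noteq> of_real (- real_of_int j)"
      unfolding of_real_eq_iff by (rule less_imp_neq[THEN not_sym])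
    thus "complex_of_real x + of_nat (2 * h + 1) \<noteq> - of_int j"
      by simp
  qed
  moreover have "complex_of_real x + of_nat h + 3 / 2 + of_nat i \<noteq> 0" for i
  proof -
    have "x + real h + 3 / 2 + real i > 0"
      using assms of_nat_0_le_iff[of h, where 'a = real] of_nat_0_le_iff[of i, where 'a = real] by linarith
    hence "complex_of_real (x + real h + 3 / 2 + real i) \<noteq> of_real 0"
      unfolding of_real_eq_iff by (rule less_imp_neq[THEN not_sym])
    thus ?thesis by simp
  qed
  ultimately show ?case
    unfolding I_cont.simps(2)[abs_def] pochhammer_prod
    by (intro analytic_intros) auto
next
  case (ge2 j)
  have "real (2 * h + 1) \<ge> 1" "real (2 * h + 1) / 2 > 0" "real (j + 1) \<ge> 1" by simp_all
  hence "real (j + 1) - 1 + real (2 * h + 1) / 2 + (x + real (2 * h + 1)) > 0"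
    using assms by linarith
  hence "complex_of_real (real (j + 1) - 1 + real (2 * h + 1) / 2 + (x + real (2 * h + 1))) \<noteq> 0"
    unfolding of_real_eq_0_iff by linarith
  hence 1: "of_nat (j + 1) - 1 + of_nat (2 * h + 1) / 2 + (complex_of_real x + of_nat (2 * h + 1)) \<noteq> 0"
    by (simp only: of_real_add of_real_diff of_real_divide of_real_of_nat_eq of_real_1 of_real_numeral not_False_eq_True)
  have 2: "(of_nat (j + 1) :: complex) \<noteq> 0"
    by (simp only: of_nat_eq_0_iff)
  show ?case
    unfolding I_cont.simps(3)[abs_def] Let_def
    by (intro analytic_intros ge2 ballI) (use 1 2 in \<open>auto simp del: of_nat_add of_nat_Suc of_nat_mult\<close>)
qed

lemma half_odd:
  assumes "h > 0"
  shows "real (2 * h + 1) / 2 > 1 / 2" "real (2 * h + 1) / 2 \<notin> \<int>"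
proof -
  have e: "real (2 * h + 1) / 2 = real h + 1 / 2"
    by (simp add: field_simps)
  have "real h > 0" using assms by simp
  thus "real (2 * h + 1) / 2 > 1 / 2" unfolding e by linarith
  show "real (2 * h + 1) / 2 \<notin> \<int>" unfolding e by (rule half_odd_not_Ints)
qed

lemma I_cont_of_real:
  assumes h: "h > 0" and s: "s > -1"
  shows "I_cont h m (of_real s) = of_real (I_integral (2 * h + 1) m s)"
proof (induction m rule: induct_nat_012)
  case 0
  show ?case using I_integral_0[OF half_odd[OF h] s] by simp
next
  case 1
  have e: "s + real (2 * h + 1) / 2 + 1 = s + real h + 3 / 2"
    by (simp add: field_simps)
  have p: "complex_of_real (pochhammer y k) = pochhammer (of_real y) k" for y k
    by (simp add: pochhammer_of_real)
  have "s + real (2 * h + 1) \<noteq> 0" using s by simp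
  hence "Z_fun h (complex_of_real s + of_nat (2 * h + 1)) = of_real (Z_fun h (s + real (2 * h + 1)))"
    using Z_fun_of_real[of "s + real (2 * h + 1)" h] by simp
  thus ?case
    unfolding I_integral_1[OF refl h s, unfolded e] One_nat_def[symmetric]
    by (simp add: p)
next
  case (ge2 j)
  define n where "n = 2 * h + 1"
  define m where "m = real j + 1"
  define v where "v = real n / 2"
  define \<sigma> where "\<sigma> = s + real n"
  have "m > 0" "m \<ge> 1" "v > 0" "\<sigma> > 0"
    using s by (simp_all add: m_def v_def \<sigma>_def n_def)
  hence pos: "m > 0" "m - 1 + v + \<sigma> > 0" by linarith+
  have "m\<^sup>2 * (m - 1 + v + \<sigma>) * I_integral n (Suc (Suc j)) s =
     2 * (m - 1 + v) * (m\<^sup>2 + (real n - 2) * m + 1 - v + \<sigma> * (1 - \<sigma>) / 2) * I_integral n (Suc j) s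
     - (m + n - 2)\<^sup>2 * (m - 1 + v - \<sigma>) * I_integral n j s"
    unfolding m_def v_def \<sigma>_def n_def by (rule I_integral_rec[OF half_odd[OF h] s])
  hence "I_integral n (Suc (Suc j)) s =
     (2 * (m - 1 + v) * (m\<^sup>2 + (real n - 2) * m + 1 - v + \<sigma> * (1 - \<sigma>) / 2) * I_integral n (Suc j) s
     - (m + n - 2)\<^sup>2 * (m - 1 + v - \<sigma>) * I_integral n j s) / (m\<^sup>2 * (m - 1 + v + \<sigma>))"
    using pos by (intro eq_divide_imp) (auto simp: mult.commute)
  moreover have "of_nat (j + 1) = complex_of_real m" "of_nat (2 * h + 1) = complex_of_real (real n)"
    "of_real s + of_nat (2 * h + 1) = complex_of_real \<sigma>" "of_nat (2 * h + 1) / 2 = complex_of_real v"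
    by (simp_all add: m_def n_def \<sigma>_def v_def)
  ultimately show ?case
    unfolding I_cont.simps(3) Let_def ge2 n_def[symmetric] by simp
qed

text \<open>\<open>I_cont\<close> with its singularities removed is a witness for the choice in
  \<open>I_mero\<close>. The identity theorem then identifies the chosen function with
  \<open>I_cont\<close> off isolated points.\<close>

lemma
  assumes h: "h > 0"
  shows I_mero_meromorphic: "I_mero (2 * h + 1) m meromorphic_on UNIV"
    and I_mero_eq_I_cont: "\<forall>\<^sub>F s in at z. I_mero (2 * h + 1) m s = I_cont h m s"
proof -
  define f where "f = I_mero (2 * h + 1) m"
  have "\<exists>f. f nicely_meromorphic_on UNIV \<and>
     (\<forall>s::real. s > -1 \<longrightarrow> f (of_real s) = of_real (I_integral (2 * h + 1) m s))"
  proof (intro exI[of _ "remove_sings (I_cont h m)"] conjI allI impI)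
    show "remove_sings (I_cont h m) nicely_meromorphic_on UNIV"
      by (intro remove_sings_nicely_meromorphic meromorphic_I_cont)
    fix s :: real assume "s > -1"
    thus "remove_sings (I_cont h m) (of_real s) = of_real (I_integral (2 * h + 1) m s)"
      using I_cont_of_real[OF h, of s m] by (simp add: analytic_I_cont)
  qed
  hence "f nicely_meromorphic_on UNIV \<and>
     (\<forall>s::real. s > -1 \<longrightarrow> f (of_real s) = of_real (I_integral (2 * h + 1) m s))"
    unfolding f_def I_mero_def by (rule someI_ex)
  hence f: "f meromorphic_on UNIV" and eq: "\<And>s::real. s > -1 \<Longrightarrow> f (of_real s) = of_real (I_integral (2 * h + 1) m s)"
    unfolding nicely_meromorphic_on_def by blast+
  show "I_mero (2 * h + 1) m meromorphic_on UNIV" using f unfolding f_def .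
  show "\<forall>\<^sub>F s in at z. I_mero (2 * h + 1) m s = I_cont h m s"
    unfolding f_def[symmetric]
    by (rule meromorphic_eq_on_reals_imp_eventually_eq[OF f meromorphic_I_cont])
       (simp only: eq I_cont_of_real[OF h])
qed

section \<open>Poles and Laurent coefficients from limits\<close>

text \<open>The limit is the residue, that is, the Laurent coefficient of index -1, also when c = 0.
  For nonzero c, division by s - z drives the values to infinity.\<close>

lemma
  fixes f :: "complex \<Rightarrow> complex"
  assumes f: "f meromorphic_on {z}" and lim: "((\<lambda>s. (s - z) * f s) \<longlongrightarrow> c) (at z)"
  shows laurent_expansion_simple_pole: "fls_nth (laurent_expansion f z) (-1) = c"
    and is_pole_simple_pole: "c \<noteq> 0 \<Longrightarrow> is_pole f z"
proof -
  have "isolated_singularity_at f z"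
    by (rule meromorphic_on_isolated_singularity[OF f])
  then obtain r where r: "r > 0" "f analytic_on ball z r - {z}"
    unfolding isolated_singularity_at_def by blast
  have "residue f z = c"
    by (rule residue_simple'[of "ball z r"])
       (use r lim in \<open>auto simp: analytic_imp_holomorphic mult.commute\<close>)
  moreover have "residue f z = fls_residue (laurent_expansion f z)"
    by (rule has_laurent_expansion_residue[OF meromorphic_on_imp_has_laurent_expansion[OF f]]) simp
  ultimately show "fls_nth (laurent_expansion f z) (-1) = c" by simp
  assume "c \<noteq> 0"
  have "filterlim (\<lambda>s. (s - z) * f s / (s - z)) at_infinity (at z)"
  proof (rule filterlim_divide_at_infinity[OF lim _ \<open>c \<noteq> 0\<close>])
    show "filterlim (\<lambda>s. s - z) (at 0) (at z)"
      unfolding filterlim_at by (auto simp: eventually_at_filter intro!: tendsto_eq_intros)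
  qed
  hence "is_pole (\<lambda>s. (s - z) * f s / (s - z)) z"
    unfolding is_pole_def .
  also have "?this \<longleftrightarrow> is_pole f z"
    by (intro is_pole_cong refl) (auto simp: eventually_at_filter)
  finally show "is_pole f z" .
qed

section \<open>Residues\<close>

text \<open>What remains of a Pochhammer symbol at a zero without its vanishing factor: i0 negative
  factors and N - 1 - i0 positive ones.\<close>

lemma prod_int_diff:
  "i0 < N \<Longrightarrow> (\<Prod>i\<in>{..<N}-{i0}. real i - real i0) = (-1) ^ i0 * fact i0 * fact (N - Suc i0)"
proof -
  assume "i0 < N"
  have "(\<Prod>i<i0. real i - real i0) = (\<Prod>i<i0. - real (i0 - i))"
    by (intro prod.cong refl) (auto simp: of_nat_diff)
  also have "\<dots> = (-1) ^ i0 * (\<Prod>i<i0. real (i0 - i))"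
    unfolding prod_uminus by simp
  also have "(\<Prod>i<i0. real (i0 - i)) = fact i0"
    by (simp add: fact_prod_rev lessThan_atLeast0)
  finally have 1: "(\<Prod>i<i0. real i - real i0) = (-1) ^ i0 * fact i0" .
  have "(\<Prod>i\<in>{Suc i0..<N}. real i - real i0) = (\<Prod>i<N - Suc i0. real (Suc i))"
    by (rule prod.reindex_bij_witness[of _ "\<lambda>i. i + Suc i0" "\<lambda>i. i - Suc i0"]) auto
  also have "\<dots> = fact (N - Suc i0)"
    by (simp add: fact_prod_Suc lessThan_atLeast0)
  finally have 2: "(\<Prod>i\<in>{Suc i0..<N}. real i - real i0) = fact (N - Suc i0)" .
  have eq: "{..<N} - {i0} = {..<i0} \<union> {Suc i0..<N}" using \<open>i0 < N\<close> by auto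
  have "{..<i0} \<inter> {Suc i0..<N} = {}" by auto
  thus ?thesis
    unfolding eq prod.union_disjoint[OF finite_lessThan finite_atLeastLessThan \<open>_ = {}\<close>] 1 2 by simp
qed

text \<open>The h negative factors of the numerator give the sign; the denominator has 2h of them,
  so there the signs cancel.\<close>

lemma R_coeff_0: "R_coeff h 0 = (-1) ^ h * (pochhammer (1 / 2) h)\<^sup>2 / (fact (2 * h))\<^sup>2"
proof -
  have "(\<Prod>j<h. (real 0)\<^sup>2 - (real j + 1 / 2)\<^sup>2) = (\<Prod>j<h. - ((1 / 2 + real j)\<^sup>2))"
    by (simp add: add.commute)
  also have "\<dots> = (-1) ^ h * (pochhammer (1 / 2) h)\<^sup>2"
    by (simp add: prod_uminus pochhammer_prod prod_power_distrib lessThan_atLeast0)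
  finally have 1: "(\<Prod>j<h. (real 0)\<^sup>2 - (real j + 1 / 2)\<^sup>2) = (-1) ^ h * (pochhammer (1 / 2) h)\<^sup>2" .
  have "{..2 * h} - {0} = {1..2 * h}" by auto
  hence "(\<Prod>i\<in>{..2*h}-{0}. (real 0)\<^sup>2 - (real i)\<^sup>2) = (\<Prod>i\<in>{1..2*h}. - ((real i)\<^sup>2))"
    by simp
  also have "\<dots> = (fact (2 * h))\<^sup>2"
    by (simp add: prod_uminus fact_prod prod_power_distrib)
  finally have 2: "(\<Prod>i\<in>{..2*h}-{0}. (real 0)\<^sup>2 - (real i)\<^sup>2) = (fact (2 * h))\<^sup>2" .
  show ?thesis unfolding R_coeff_def 1 2 ..
qed

text \<open>Lowering the index from k + 1 to k costs (k + 1)/(\<sigma> + k), a ratio of linear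
  factors in l. This is the origin of the parameters 1 - m and 2 - \<sigma> - m; the condition on
  \<sigma> keeps \<sigma> + k nonzero.\<close>

lemma binom_coeff_reflect:
  assumes "l < m" "\<And>k::nat. \<sigma> \<noteq> - real k"
  shows "binom_coeff \<sigma> (m - 1) * (pochhammer (1 - real m) l / pochhammer (2 - \<sigma> - real m) l) =
         binom_coeff \<sigma> (m - 1 - l)"
  using assms(1)
proof (induction l)
  case (Suc l)
  define k where "k = m - 1 - Suc l"
  have k: "m - 1 - l = Suc k" "real m = real k + real l + 2"
    using Suc.prems by (auto simp: k_def)
  have nz: "\<sigma> + real k \<noteq> 0"
    using assms(2)[of k] by (simp add: eq_neg_iff_add_eq_0)
  have e: "1 - real m + real l = - (real k + 1)" "2 - \<sigma> - real m + real l = - (\<sigma> + real k)"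
    using k(2) by simp_all
  have "binom_coeff \<sigma> (m - 1) * (pochhammer (1 - real m) (Suc l) / pochhammer (2 - \<sigma> - real m) (Suc l)) =
        binom_coeff \<sigma> (Suc k) * ((real k + 1) / (\<sigma> + real k))"
  proof -
    have "binom_coeff \<sigma> (m - 1) * (pochhammer (1 - real m) (Suc l) / pochhammer (2 - \<sigma> - real m) (Suc l)) =
          binom_coeff \<sigma> (m - 1) * (pochhammer (1 - real m) l / pochhammer (2 - \<sigma> - real m) l)
            * (- (real k + 1) / - (\<sigma> + real k))"
      by (simp only: pochhammer_Suc e times_divide_times_eq mult.assoc)
    also have "binom_coeff \<sigma> (m - 1) * (pochhammer (1 - real m) l / pochhammer (2 - \<sigma> - real m) l) =
        binom_coeff \<sigma> (m - 1 - l)"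
      using Suc.IH Suc.prems by simp
    finally show ?thesis unfolding k(1) minus_divide_divide .
  qed
  also have "\<dots> = binom_coeff \<sigma> k"
    using binom_coeff_Suc[of \<sigma> k] nz by (simp add: field_simps)
  finally show ?case unfolding k_def .
qed auto

text \<open>The factor (1 - m)_l ends the series at l = m - 1, and the reflected binomial factor
  turns it into the convolution. The lower parameters enter through their Pochhammer product because
  the two cases list them in different orders.\<close>

lemma hypergeo_eq_conv_sum:
  fixes \<sigma> v :: real
  assumes m: "m \<ge> 1" and \<sigma>: "\<And>k::nat. \<sigma> \<noteq> - real k"
    and as: "as = [1 - \<sigma>, v, 2 * v - \<sigma>, 1 - real m]"
    and bs: "\<And>l. foldl (\<lambda>r b. r * pochhammer b l) 1 bs =
               pochhammer (v + 1 - \<sigma>) l * pochhammer (2 * v) l * pochhammer (2 - \<sigma> - real m) l"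
  shows "binom_coeff \<sigma> (m - 1) * hypergeo as bs 1 = conv_sum v \<sigma> m"
proof -
  define c where "c = fps_nth (fps_hypergeo as bs 1)"
  have c: "c l = conv_coeff v \<sigma> l * (pochhammer (1 - real m) l / pochhammer (2 - \<sigma> - real m) l)" for l
    unfolding c_def fps_hypergeo_nth bs by (simp add: as conv_coeff_def mult_ac)
  have "c l = 0" if "l \<ge> m" for l
  proof -
    have "pochhammer (1 - real m) l = 0"
      unfolding pochhammer_eq_0_iff using that m by (intro exI[of _ "m - 1"]) (auto simp: of_nat_diff)
    thus ?thesis by (simp add: c)
  qed
  hence "(\<Sum>l. c l * 1 ^ l) = (\<Sum>l<m. c l)"
    by (subst suminf_finite[of "{..<m}"]) auto
  hence "binom_coeff \<sigma> (m - 1) * hypergeo as bs 1 = (\<Sum>l<m. binom_coeff \<sigma> (m - 1) * c l)"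
    by (simp add: hypergeo_def eval_fps_def c_def sum_distrib_left)
  also have "\<dots> = (\<Sum>l<m. conv_coeff v \<sigma> l * binom_coeff \<sigma> (m - 1 - l))"
  proof (intro sum.cong refl)
    fix l assume "l \<in> {..<m}"
    hence "binom_coeff \<sigma> (m - 1) * (pochhammer (1 - real m) l / pochhammer (2 - \<sigma> - real m) l) =
         binom_coeff \<sigma> (m - 1 - l)"
      by (intro binom_coeff_reflect \<sigma>) auto
    thus "binom_coeff \<sigma> (m - 1) * c l = conv_coeff v \<sigma> l * binom_coeff \<sigma> (m - 1 - l)"
      unfolding c by (simp only: mult.left_commute)
  qed
  finally show ?thesis by (simp add: conv_sum_def)
qed

section \<open>Residues as m varies\<close>

text \<open>Gauge factor carrying the recurrence of the convolutions over to that of the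
  I_m.\<close>

definition res_weight :: "real \<Rightarrow> real \<Rightarrow> nat \<Rightarrow> real" where
  "res_weight v \<sigma> i = pochhammer (2 * v) i / fact i * (pochhammer (1 + v - \<sigma>) i / pochhammer (v + \<sigma>) i)"

text \<open>Residue of I_m relative to that of I_1: the values 0 and 1 at m = 0 and m = 1 start the
  recurrence.\<close>

fun res_seq :: "real \<Rightarrow> real \<Rightarrow> nat \<Rightarrow> real" where
  "res_seq v \<sigma> 0 = 0"
| "res_seq v \<sigma> (Suc i) = res_weight v \<sigma> i * conv_sum v \<sigma> (Suc i)"

text \<open>The weight satisfies a first-order recurrence whose factors account for the discrepancy
  between the two three-term recurrences. The bounds on \<sigma> keep the denominators
  positive.\<close>

lemma res_seq_rec:
  fixes v \<sigma> m :: real and j :: nat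
  assumes v: "v > 0" and \<sigma>: "\<sigma> < v + 1" "v + \<sigma> > 0" and m: "m = real j + 1"
  shows "res_seq v \<sigma> (Suc (Suc j)) =
    (2 * (m - 1 + v) * (m\<^sup>2 + (2 * v - 2) * m + 1 - v + \<sigma> * (1 - \<sigma>) / 2) * res_seq v \<sigma> (Suc j)
       - (m + 2 * v - 2)\<^sup>2 * (m - 1 + v - \<sigma>) * res_seq v \<sigma> j) / (m\<^sup>2 * (m - 1 + v + \<sigma>))"
proof (rule eq_divide_imp)
  show "m\<^sup>2 * (m - 1 + v + \<sigma>) \<noteq> 0"
  proof -
    have "m > 0" "m - 1 + v + \<sigma> > 0" using \<sigma> by (simp_all add: m)
    thus ?thesis by simp
  qed
  define W where "W = res_weight v \<sigma>"
  have W_Suc: "W (Suc i) * ((real i + 1) * (v + \<sigma> + i)) = W i * ((2 * v + i) * (1 + v - \<sigma> + i))" for i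
  proof -
    have "v + \<sigma> + i > 0" using \<sigma> by simp
    moreover have "A * a / (F * f) * (B * b / (C * c)) * (f * c) = A / F * (B / C) * (a * b)"
      if "f > 0" "c > 0" for A B C F a b c f :: real
      using that by (simp add: divide_simps)
    ultimately show ?thesis
      by (simp add: W_def res_weight_def pochhammer_Suc add.commute mult.commute)
  qed
  have "res_seq v \<sigma> (Suc (Suc j)) * (m\<^sup>2 * (m - 1 + v + \<sigma>)) =
     (W (Suc j) * ((real j + 1) * (v + \<sigma> + j))) * m * conv_sum v \<sigma> (Suc (Suc j))"
    by (simp add: W_def m power2_eq_square algebra_simps)
  also have "\<dots> = W j * (real (j + 1) * (j + 2 * v) * (j + v + 1 - \<sigma>) * conv_sum v \<sigma> (Suc (Suc j)))"
  proof -
    have "1 + v - \<sigma> + real j = j + v + 1 - \<sigma>" "2 * v + real j = j + 2 * v" "m = real (j + 1)"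
      by (simp_all add: m)
    thus ?thesis unfolding W_Suc by (simp only: mult_ac)
  qed
  also have "real (j + 1) * (j + 2 * v) * (j + v + 1 - \<sigma>) * conv_sum v \<sigma> (Suc (Suc j)) =
     (2 * real j + 2 * v) * ((real j)\<^sup>2 + 2 * v * j + v + \<sigma> * (1 - \<sigma>) / 2) * conv_sum v \<sigma> (Suc j)
       - j * (j + 2 * v - 1) * (j + v + \<sigma> - 1) * conv_sum v \<sigma> j"
    using conv_sum_rec[OF v \<sigma>(1), of j] by linarith
  also have "W j * \<dots> = (2 * real j + 2 * v) * ((real j)\<^sup>2 + 2 * v * j + v + \<sigma> * (1 - \<sigma>) / 2) * res_seq v \<sigma> (Suc j)
     - W j * (j * (j + 2 * v - 1) * (j + v + \<sigma> - 1)) * conv_sum v \<sigma> j"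
    by (simp add: W_def algebra_simps)
  also have "W j * (j * (j + 2 * v - 1) * (j + v + \<sigma> - 1)) * conv_sum v \<sigma> j =
      (m + 2 * v - 2)\<^sup>2 * (m - 1 + v - \<sigma>) * res_seq v \<sigma> j"
  \<comment> \<open>For j = 0 both sides vanish, by the factor j and by
    \<open>res_seq v \<sigma> 0 = 0\<close>.\<close>
  proof (cases j)
    case (Suc i)
    have "W j * (j * (j + 2 * v - 1) * (j + v + \<sigma> - 1)) = (W (Suc i) * ((real i + 1) * (v + \<sigma> + i))) * (2 * v + i)"
      by (simp add: Suc algebra_simps)
    also have "\<dots> = W i * ((m + 2 * v - 2)\<^sup>2 * (m - 1 + v - \<sigma>))"
      unfolding W_Suc by (simp add: m Suc power2_eq_square algebra_simps)
    finally show ?thesis by (simp add: Suc W_def)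
  qed auto
  also have "(2 * real j + 2 * v) * ((real j)\<^sup>2 + 2 * v * j + v + \<sigma> * (1 - \<sigma>) / 2) =
     2 * (m - 1 + v) * (m\<^sup>2 + (2 * v - 2) * m + 1 - v + \<sigma> * (1 - \<sigma>) / 2)"
    by (simp add: m power2_eq_square algebra_simps)
  finally show "res_seq v \<sigma> (Suc (Suc j)) * (m\<^sup>2 * (m - 1 + v + \<sigma>)) =
    2 * (m - 1 + v) * (m\<^sup>2 + (2 * v - 2) * m + 1 - v + \<sigma> * (1 - \<sigma>) / 2) * res_seq v \<sigma> (Suc j)
       - (m + 2 * v - 2)\<^sup>2 * (m - 1 + v - \<sigma>) * res_seq v \<sigma> j" .
qed

lemma res_seq_nonneg:
  assumes "v > 0" "\<sigma> < v + 1" "v + \<sigma> > 0" "\<And>i. conv_sum v \<sigma> i \<ge> 0"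
  shows "res_seq v \<sigma> m \<ge> 0"
proof (cases m)
  case (Suc i)
  have "res_weight v \<sigma> i \<ge> 0"
    unfolding res_weight_def using assms
    by (intro mult_nonneg_nonneg divide_nonneg_nonneg pochhammer_nonneg) auto
  thus ?thesis using Suc assms(4) by simp
qed simp

text \<open>The denominator factor with index i0 vanishes at x and cancels s - x. The rest is
  analytic there, since x + n is not an integer and thus no pole of \<open>Z_fun\<close>.\<close>

lemma I_cont_1_limit:
  fixes x :: real
  assumes x: "x + real h + 3 / 2 + real i0 = 0" "i0 < 2 * h"
    and y: "\<And>j::int. x + real (2 * h + 1) \<noteq> of_int j"
  shows "((\<lambda>s. (s - of_real x) * I_cont h 1 s) \<longlongrightarrow>
    of_real (2 * (2 * real h)\<^sup>2 * (pochhammer (x + 1) (4 * h) / ((-1) ^ i0 * fact i0 * fact (2 * h - Suc i0)))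
      * Z_fun h (x + real (2 * h + 1)))) (at (of_real x))"
proof -
  define P where "P = (\<lambda>s::complex. \<Prod>i\<in>{..<2*h}-{i0}. s + of_nat h + 3 / 2 + of_nat i)"
  define g where "g = (\<lambda>s. 2 * (2 * of_nat h)\<^sup>2 * (pochhammer (s + 1) (4 * h) / P s) * Z_fun h (s + of_nat (2 * h + 1)))"
  have shift: "x + real h + 3 / 2 + real i = real i - real i0" for i
    using x(1) by linarith
  have "P (of_real x) = of_real (\<Prod>i\<in>{..<2*h}-{i0}. x + real h + 3 / 2 + real i)"
    by (simp add: P_def)
  also have "\<dots> = of_real ((-1) ^ i0 * fact i0 * fact (2 * h - Suc i0))"
    unfolding shift prod_int_diff[OF x(2)] ..
  finally have P: "P (of_real x) = of_real ((-1) ^ i0 * fact i0 * fact (2 * h - Suc i0))" .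
  have y': "complex_of_real x + of_nat (2 * h + 1) \<noteq> - of_int j" for j
  proof -
    have "complex_of_real (x + real (2 * h + 1)) \<noteq> of_real (of_int (- j))"
      using y[of "- j"] unfolding of_real_eq_iff .
    thus ?thesis by simp
  qed
  have "g analytic_on {of_real x}"
    unfolding g_def pochhammer_prod
    by (intro analytic_intros analytic_Z_fun y') (auto simp: P, auto simp: P_def intro!: analytic_intros)
  hence "(g \<longlongrightarrow> g (of_real x)) (at (of_real x))"
    using analytic_at_imp_isCont isContD by blast
  moreover have "\<forall>\<^sub>F s in at (of_real x). g s = (s - of_real x) * I_cont h 1 s"
  proof -
    have "\<forall>\<^sub>F s in at (of_real x). s \<noteq> complex_of_real x"
      by (simp add: eventually_at_filter)
    thus ?thesis
    proof eventually_elim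
      case (elim s)
      have "complex_of_real (x + real h + 3 / 2 + real i0) = of_real 0" using x(1) by (simp only:)
      hence e1: "s + of_nat h + 3 / 2 + of_nat i0 = s - of_real x"
        by (simp add: algebra_simps add_eq_0_iff)
      have e2: "pochhammer (s + of_nat h + 3 / 2) (2 * h) = (s + of_nat h + 3 / 2 + of_nat i0) * P s"
        unfolding pochhammer_prod P_def using x(2)
        by (subst prod.remove[of _ i0]) (auto simp: lessThan_atLeast0)
      show ?case using elim unfolding One_nat_def I_cont.simps(2) e2 e1 g_def by simp
    qed
  qed
  ultimately have "((\<lambda>s. (s - of_real x) * I_cont h 1 s) \<longlongrightarrow> g (of_real x)) (at (of_real x))"
    by (rule Lim_transform_eventually)
  moreover have "Z_fun h (complex_of_real x + of_nat (2 * h + 1)) = of_real (Z_fun h (x + real (2 * h + 1)))"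
    using Z_fun_of_real[of "x + real (2 * h + 1)" h] y[of 0] by simp
  moreover have "pochhammer (complex_of_real x + 1) (4 * h) = of_real (pochhammer (x + 1) (4 * h))"
    using pochhammer_of_real[of "x + 1" "4 * h", where 'a = complex] by simp
  ultimately show ?thesis
    unfolding g_def P by simp
qed

text \<open>Multiplied by s - x, the recurrence passes to the limit: its coefficients are
  polynomials in s, and the bounds on \<sigma> keep the divisor from vanishing at x.\<close>

lemma I_cont_limit:
  fixes x r :: real and h :: nat
  defines "n \<equiv> 2 * h + 1"
  defines "v \<equiv> real n / 2" and "\<sigma> \<equiv> x + real n"
  assumes \<sigma>: "\<sigma> < v + 1" "v + \<sigma> > 0"
    and lim: "((\<lambda>s. (s - of_real x) * I_cont h 1 s) \<longlongrightarrow> of_real r) (at (of_real x))"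
  shows "((\<lambda>s. (s - of_real x) * I_cont h m s) \<longlongrightarrow> of_real (r * res_seq v \<sigma> m)) (at (of_real x))"
proof (induction m rule: induct_nat_012)
  case 0
  have "((\<lambda>s. (s - of_real x) * 1) \<longlongrightarrow> (of_real x - of_real x) * 1) (at (complex_of_real x))"
    by (intro tendsto_intros)
  thus ?case by simp
next
  case 1
  thus ?case using lim by (simp add: res_weight_def)
next
  case (ge2 j)
  define m where "m = real j + 1"
  define a where "a = (\<lambda>s::complex. 2 * (of_nat (j + 1) - 1 + of_nat n / 2) * ((of_nat (j + 1))\<^sup>2 + (of_nat n - 2) * of_nat (j + 1) + 1 - of_nat n / 2
      + (s + of_nat n) * (1 - (s + of_nat n)) / 2))"
  define b where "b = (\<lambda>s::complex. (of_nat (j + 1) + of_nat n - 2)\<^sup>2 * (of_nat (j + 1) - 1 + of_nat n / 2 - (s + of_nat n)))"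
  define c where "c = (\<lambda>s::complex. (of_nat (j + 1))\<^sup>2 * (of_nat (j + 1) - 1 + of_nat n / 2 + (s + of_nat n)))"
  have I: "I_cont h (Suc (Suc j)) s = (a s * I_cont h (Suc j) s - b s * I_cont h j s) / c s" for s
    unfolding I_cont.simps(3) Let_def a_def b_def c_def n_def ..
  have cast: "complex_of_nat (j + 1) = of_real m" "complex_of_nat n = of_real (real n)" "complex_of_real (real n) / 2 = complex_of_real v"
    "complex_of_real x + complex_of_real (real n) = complex_of_real \<sigma>"
    by (simp_all add: m_def v_def \<sigma>_def)
  have ax: "a (of_real x) = of_real (2 * (m - 1 + v) * (m\<^sup>2 + (real n - 2) * m + 1 - v + \<sigma> * (1 - \<sigma>) / 2))"
    unfolding a_def cast by simp
  have bx: "b (of_real x) = of_real ((m + real n - 2)\<^sup>2 * (m - 1 + v - \<sigma>))"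
    unfolding b_def cast by simp
  have cx: "c (of_real x) = of_real (m\<^sup>2 * (m - 1 + v + \<sigma>))"
    unfolding c_def cast by simp
  have "m > 0" "m - 1 + v + \<sigma> > 0" using \<sigma> by (simp_all add: m_def)
  hence "m\<^sup>2 * (m - 1 + v + \<sigma>) \<noteq> 0" by simp
  hence c0: "c (of_real x) \<noteq> 0" unfolding cx of_real_eq_0_iff .
  have "(a \<longlongrightarrow> a (of_real x)) (at (of_real x))" "(b \<longlongrightarrow> b (of_real x)) (at (of_real x))" "(c \<longlongrightarrow> c (of_real x)) (at (of_real x))"
    unfolding a_def b_def c_def by (intro tendsto_intros; simp)+
  hence "((\<lambda>s. (a s * ((s - of_real x) * I_cont h (Suc j) s) - b s * ((s - of_real x) * I_cont h j s)) / c s)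
      \<longlongrightarrow> (a (of_real x) * of_real (r * res_seq v \<sigma> (Suc j)) - b (of_real x) * of_real (r * res_seq v \<sigma> j)) / c (of_real x))
      (at (of_real x))"
    by (intro tendsto_divide tendsto_diff tendsto_mult ge2 c0)
  also have "(\<lambda>s. (a s * ((s - of_real x) * I_cont h (Suc j) s) - b s * ((s - of_real x) * I_cont h j s)) / c s) =
     (\<lambda>s. (s - of_real x) * I_cont h (Suc (Suc j)) s)"
    unfolding I by (simp add: fun_eq_iff right_diff_distrib mult.left_commute)
  also have "(a (of_real x) * of_real (r * res_seq v \<sigma> (Suc j)) - b (of_real x) * of_real (r * res_seq v \<sigma> j)) / c (of_real x) =
      of_real (r * res_seq v \<sigma> (Suc (Suc j)))"
  proof -
    have n: "real n = 2 * v" by (simp add: v_def)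
    have "v > 0" by (simp add: v_def n_def)
    have "(A * (r * s) - B * (r * s')) / C = r * ((A * s - B * s') / C)" for A B C s s' :: real
      by (simp add: right_diff_distrib mult.left_commute)
    thus ?thesis
      unfolding res_seq_rec[OF \<open>v > 0\<close> \<sigma> m_def] ax bx cx n
        of_real_mult[symmetric] of_real_diff[symmetric] of_real_divide[symmetric] by (simp only:)
  qed
  finally show ?case .
qed

section \<open>Closed forms in Gamma values\<close>

lemma Gamma_half_nat: "Gamma (real k + 1 / 2) = pochhammer (1 / 2) k * sqrt pi"
proof -
  have "(1 / 2 :: real) \<notin> \<int>\<^sub>\<le>\<^sub>0" by (auto elim!: nonpos_Ints_cases)
  from pochhammer_Gamma[OF this, of k] show ?thesis
    by (simp add: Gamma_one_half_real add.commute)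
qed

lemma Gamma_real_nat: "k > 0 \<Longrightarrow> Gamma (real k) = fact (k - 1)"
  using Gamma_fact[of "k - 1", where ?'a = real] by (simp add: of_nat_diff)

lemma pochhammer_half_centred:
  "pochhammer (1 / 2 - 2 * real h) (4 * h) = (pochhammer (1 / 2) (2 * h))\<^sup>2"
proof -
  have "pochhammer (0 - real (2 * h) + 1 / 2) (2 * (2 * h)) = (\<Prod>j<2*h. 0\<^sup>2 - (real j + 1 / 2)\<^sup>2)"
    by (rule pochhammer_centred_odd)
  also have "\<dots> = (\<Prod>j<2*h. - ((1 / 2 + real j)\<^sup>2))"
    by (simp add: add.commute)
  also have "\<dots> = (pochhammer (1 / 2) (2 * h))\<^sup>2"
    by (simp add: prod_uminus pochhammer_prod prod_power_distrib lessThan_atLeast0)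
  finally show ?thesis by (simp add: algebra_simps)
qed

text \<open>The sign (-1)^h of \<open>R_coeff h 0\<close> meets (-1)^(h-1) from the cancelled
  denominator, so the residue is negative. The factor pi^2 is absorbed by four Gamma values at
  half-integers.\<close>

lemma res_1_one_half:
  assumes h: "h > 0"
  shows "2 * (2 * real h)\<^sup>2 * (pochhammer (1 / 2 - 2 * real h) (4 * h) / ((-1) ^ (h - 1) * fact (h - 1) * fact h))
      * (R_coeff h 0 * (pi\<^sup>2 / 2)) =
    - ((Gamma (real h + 1 / 2))\<^sup>2 * (Gamma (real (2 * h) + 1 / 2))\<^sup>2 /
        (Gamma (real h) * (Gamma (real (2 * h)))\<^sup>2 * Gamma (real (Suc h))))"
proof -
  define P p F where "P = pochhammer (1 / 2 :: real) (2 * h)" and "p = pochhammer (1 / 2 :: real) h"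
    and "F = (fact (2 * h - 1) :: real)"
  have F: "fact (2 * h) = 2 * real h * F"
    unfolding F_def using h by (subst fact_reduce) auto
  have s: "(-1 :: real) ^ h = - ((-1) ^ (h - 1))"
    using h by (cases h) auto
  have G: "Gamma (real h) = fact (h - 1)" "Gamma (real (2 * h)) = F" "Gamma (real (Suc h)) = fact h"
    unfolding F_def using h by (subst Gamma_real_nat; simp)+
  have gen: "2 * H\<^sup>2 * (Q / (e * f * g)) * (- e * q / (H * F')\<^sup>2 * (w / 2)) = - ((q * w * Q) / (f * F'\<^sup>2 * g))"
    if "H > 0" "e \<noteq> 0" "f > 0" "g > 0" "F' > 0" for H Q e f g q w F' :: real
    using that by (simp add: divide_simps power_mult_distrib)
  have sq: "(p * sqrt pi)\<^sup>2 * (P * sqrt pi)\<^sup>2 = p\<^sup>2 * pi\<^sup>2 * P\<^sup>2"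
    by (simp add: power_mult_distrib power2_eq_square[of pi])
  show ?thesis
    unfolding R_coeff_0 pochhammer_half_centred Gamma_half_nat G F s P_def[symmetric] p_def[symmetric] sq
    by (rule gen) (use h in \<open>auto simp: F_def\<close>)
qed

text \<open>Here the powers of -1 cancel. The minus sign arises from moving the Pochhammer block
  down by one, which exchanges the factor 2h - 1/2 for -(2h + 1/2).\<close>

lemma res_1_minus_one_half:
  assumes h: "h > 0"
  shows "2 * (2 * real h)\<^sup>2 * (pochhammer (- 1 / 2 - 2 * real h) (4 * h) / ((-1) ^ h * fact h * fact (h - 1)))
      * (R_coeff h 0 * (pi\<^sup>2 / 2)) =
    - ((Gamma (real h + 1 / 2))\<^sup>2 * Gamma (real (2 * h - 1) + 1 / 2) * Gamma (real (2 * h + 1) + 1 / 2) /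
        (Gamma (real h) * (Gamma (real (2 * h)))\<^sup>2 * Gamma (real (Suc h))))"
proof -
  define P p F where "P = pochhammer (1 / 2 :: real) (2 * h)" and "p = pochhammer (1 / 2 :: real) h"
    and "F = (fact (2 * h - 1) :: real)"
  have F: "fact (2 * h) = 2 * real h * F"
    unfolding F_def using h by (subst fact_reduce) auto
  have G: "Gamma (real h) = fact (h - 1)" "Gamma (real (2 * h)) = F" "Gamma (real (Suc h)) = fact h"
    unfolding F_def using h by (subst Gamma_real_nat; simp)+
  have h1: "real h \<ge> 1" using h by simp
  define a where "a = 2 * real h + 1 / 2"
  define b where "b = 2 * real h - 1 / 2"
  have ab: "a > 0" "b > 0" using h1 by (simp_all add: a_def b_def)
  have "pochhammer (1 / 2 :: real) (Suc (2 * h)) = P * a"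
    unfolding pochhammer_Suc P_def a_def by (simp add: add.commute)
  hence G1: "Gamma (real (2 * h + 1) + 1 / 2) = P * a * sqrt pi"
    unfolding Gamma_half_nat by simp
  have "pochhammer (1 / 2 :: real) (Suc (2 * h - 1)) = pochhammer (1 / 2) (2 * h - 1) * b"
    unfolding pochhammer_Suc b_def using h by (simp add: of_nat_diff)
  hence "P = pochhammer (1 / 2) (2 * h - 1) * b"
    unfolding P_def using h by simp
  hence "pochhammer (1 / 2) (2 * h - 1) = P / b"
    using ab by simp
  hence G2: "Gamma (real (2 * h - 1) + 1 / 2) = P / b * sqrt pi"
    unfolding Gamma_half_nat by simp
  have "pochhammer (- 1 / 2 - 2 * real h) (4 * h) * b = - a * pochhammer (1 / 2 - 2 * real h) (4 * h)"
    using pochhammer_rec[of "- 1 / 2 - 2 * real h" "4 * h"] pochhammer_Suc[of "- 1 / 2 - 2 * real h" "4 * h"]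
    by (simp add: a_def b_def algebra_simps)
  hence pc: "pochhammer (- 1 / 2 - 2 * real h) (4 * h) = - a * P\<^sup>2 / b"
    unfolding pochhammer_half_centred P_def using ab by (simp add: field_simps)
  have gen: "2 * H\<^sup>2 * ((- a * Q / b) / (e * f * g)) * (e * q / (H * F')\<^sup>2 * (w / 2)) = - ((q * w * (a * Q / b)) / (g * F'\<^sup>2 * f))"
    if "H > 0" "e \<noteq> 0" "f > 0" "g > 0" "F' > 0" for H Q e f g q w F' :: real
    using that ab by (simp add: divide_simps power_mult_distrib)
  have sq: "(p * sqrt pi)\<^sup>2 * (P / b * sqrt pi) * (P * a * sqrt pi) = p\<^sup>2 * pi\<^sup>2 * (a * P\<^sup>2 / b)"
    by (simp add: power_mult_distrib power2_eq_square[of pi] power2_eq_square[of P])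
  show ?thesis
    unfolding R_coeff_0 pc G1 G2 Gamma_half_nat[of h] G F p_def[symmetric] sq
    by (rule gen) (use h in \<open>auto simp: F_def\<close>)
qed

text \<open>At \<sigma> = 1/2 the parameters 1 + v - \<sigma> and v + \<sigma> coincide, so the
  weight is just (n)_i / i!. The factor Gamma(m - 1/2) comes from the binomial coefficient in front
  of the 4F3.\<close>

lemma closed_form_one_half:
  fixes h i :: nat
  defines "n \<equiv> 2 * h + 1" and "m \<equiv> Suc i" and "v \<equiv> real h + 1 / 2"
  assumes h: "h > 0"
  shows "- ((Gamma (real h + 1 / 2))\<^sup>2 * (Gamma (real (2 * h) + 1 / 2))\<^sup>2 /
        (Gamma (real h) * (Gamma (real (2 * h)))\<^sup>2 * Gamma (real (Suc h)))) * res_seq v (1 / 2) m =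
    - (Gamma (real m + real n - 1) * Gamma (real m - 1 / 2) * (Gamma (real n / 2))\<^sup>2
               * (Gamma (real n - 1 / 2))\<^sup>2
             / (Gamma (1 / 2) * (Gamma (real m))\<^sup>2 * Gamma ((real n - 1) / 2) * Gamma (real n)
               * (Gamma (real n - 1))\<^sup>2 * Gamma ((real n + 1) / 2)))
          * hypergeo [1 / 2, real n / 2, real n - 1 / 2, 1 - real m]
                     [(real n + 1) / 2, real n, 3 / 2 - real m] 1"
proof -
  define N where "N = pochhammer (real n) i"
  define B where "B = binom_coeff (1 / 2) i"
  define D where "D = conv_sum v (1 / 2) m"
  have v: "v > 0" "2 * v = real n" "v + 1 - 1 / 2 = (real n + 1) / 2" "2 * v - 1 / 2 = real n - 1 / 2"
    "v = real n / 2"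
    by (simp_all add: v_def n_def field_simps)
  have D: "D = B * hypergeo [1 / 2, real n / 2, real n - 1 / 2, 1 - real m]
                     [(real n + 1) / 2, real n, 3 / 2 - real m] 1"
  proof -
    have "(1 / 2 :: real) \<noteq> - real k" for k
    proof -
      have "real k \<ge> 0" by simp
      thus ?thesis by linarith
    qed
    from hypergeo_eq_conv_sum[of m "1 / 2" "[1 / 2, real n / 2, real n - 1 / 2, 1 - real m]" v
        "[(real n + 1) / 2, real n, 3 / 2 - real m]", OF _ this] show ?thesis
      unfolding D_def B_def by (simp add: m_def v(2-4)) (simp add: v(5))
  qed
  have nz: "N > 0" "B > 0" "Gamma (real n) > 0" "Gamma (real h) > 0" "Gamma (real (2 * h)) > 0" "Gamma (real (Suc h)) > 0"
    unfolding N_def B_def binom_coeff_def using h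
    by (auto intro!: pochhammer_pos divide_pos_pos Gamma_real_pos simp: n_def)
  have "pochhammer (v + 1 / 2) i > 0" using v(1) by (intro pochhammer_pos) simp
  hence R: "res_seq v (1 / 2) m = N / fact i * D"
    unfolding D_def N_def m_def by (simp add: res_weight_def v(2) add.commute)
  have "real n \<notin> \<int>\<^sub>\<le>\<^sub>0" by (auto simp: n_def elim!: nonpos_Ints_cases)
  hence G1: "Gamma (real m + real n - 1) = Gamma (real n) * N"
    using pochhammer_Gamma[of "real n" i] nz(3) by (simp add: N_def m_def add.commute field_simps)
  have "real m - 1 / 2 = real i + 1 / 2" by (simp add: m_def)
  hence G2: "Gamma (real m - 1 / 2) = B * fact i * Gamma (1 / 2)"
    by (simp only: Gamma_half_nat) (simp add: B_def binom_coeff_def Gamma_one_half_real)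
  have G3: "Gamma (real m) = fact i"
    unfolding m_def by (subst Gamma_real_nat) auto
  have G4: "real (2 * h) / 2 = real h" "(real n + 1) / 2 = real (Suc h)" "real n - 1 = real (2 * h)"
     "real n / 2 = real h + 1 / 2" "real n - 1 / 2 = real (2 * h) + 1 / 2"
    by (simp_all add: n_def field_simps)
  have Q: "Gamma (1 / 2 :: real) > 0" by (intro Gamma_real_pos) simp
  have gen: "- (V * W / (gh * K * gh1)) * (N / f * (B * hyp)) =
        - (gn * N * (B * f * Q) * V * W / (Q * f\<^sup>2 * gh * gn * K * gh1)) * hyp"
    if "Q > 0" "f > 0" "gn > 0" for V W gh K gh1 f hyp gn Q N B :: real
    using that by (simp add: divide_simps power2_eq_square)
  show ?thesis
    unfolding R D G1 G2 G3 unfolding G4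
    by (rule gen) (use nz Q in auto)
qed

lemma half_minus_int_ne: "- (1 / 2) + real_of_int k \<noteq> real_of_int j"
proof
  assume "- (1 / 2) + real_of_int k = real_of_int j"
  hence "real_of_int (2 * k) = real_of_int (2 * j + 1)" by simp
  hence "2 * k = 2 * j + 1" by (simp only: of_int_eq_iff)
  thus False by presburger
qed

lemma minus_half_not_nonpos_Ints: "(- 1 / 2 :: real) \<notin> \<int>\<^sub>\<le>\<^sub>0"
  using half_minus_int_ne[of 0] by (auto elim!: nonpos_Ints_cases)

lemma Gamma_reflection_real: "Gamma x * Gamma (1 - x) = pi / sin (pi * x)" for x :: real
proof -
  have "Gamma (1 - complex_of_real x) = of_real (Gamma (1 - x))"
    using Gamma_complex_of_real[of "1 - x"] by simp
  moreover have "sin (complex_of_real pi * of_real x) = of_real (sin (pi * x))"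
    using sin_of_real[of "pi * x", where 'a = complex] by simp
  ultimately have "complex_of_real (Gamma x * Gamma (1 - x)) = of_real (pi / sin (pi * x))"
    using Gamma_reflection_complex[of "of_real x"]
    by (simp only: of_real_mult of_real_divide Gamma_complex_of_real)
  thus ?thesis by (simp only: of_real_eq_iff)
qed

text \<open>The quotient in the weight now survives as Gamma(m + n/2 + 1/2) over Gamma(m + n/2 -
  3/2). Reflection trades one Gamma(n/2) for 1/Gamma(1 - n/2) with sign (-1)^h, which the leading
  power of -1 compensates, as (n - 3)/2 = h - 1.\<close>

lemma closed_form_minus_one_half:
  fixes h i :: nat
  defines "n \<equiv> 2 * h + 1" and "m \<equiv> Suc i" and "v \<equiv> real h + 1 / 2"
  assumes h: "h > 0"
  shows "- ((Gamma (real h + 1 / 2))\<^sup>2 * Gamma (real (2 * h - 1) + 1 / 2) * Gamma (real (2 * h + 1) + 1 / 2) /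
        (Gamma (real h) * (Gamma (real (2 * h)))\<^sup>2 * Gamma (real (Suc h)))) * res_seq v (- 1 / 2) m =
    (-1) ^ ((n - 3) div 2) *
          (- (Gamma (3 / 2) * Gamma (real m + real n - 1) * Gamma (real n / 2)
               * Gamma (real n - 3 / 2) * Gamma (real n + 1 / 2)
               * Gamma (real m + real n / 2 + 1 / 2) * Gamma (real m - 3 / 2)
             / ((Gamma (real n - 1))\<^sup>2 * (Gamma (real m))\<^sup>2 * Gamma (real m + real n / 2 - 3 / 2)
               * Gamma ((real n + 1) / 2) * Gamma ((real n + 3) / 2) * Gamma (1 - real n / 2)
               * Gamma (real n)))
          * hypergeo [3 / 2, real n / 2, real n + 1 / 2, 1 - real m]
                     [(real n + 3) / 2, 5 / 2 - real m, real n] 1)"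
proof -
  define N where "N = pochhammer (real n) i"
  define B where "B = binom_coeff (- 1 / 2) i"
  define D where "D = conv_sum v (- 1 / 2) m"
  define X where "X = pochhammer (v + 3 / 2) i"
  define Y where "Y = pochhammer (real h) i"
  define e where "e = (-1 :: real) ^ h"
  have v: "v > 0" "2 * v = real n" "v + 1 - (- 1 / 2) = (real n + 3) / 2" "2 * v - (- 1 / 2) = real n + 1 / 2"
    "v = real n / 2"
    by (simp_all add: v_def n_def field_simps)
  have D: "D = B * hypergeo [3 / 2, real n / 2, real n + 1 / 2, 1 - real m]
                     [(real n + 3) / 2, 5 / 2 - real m, real n] 1"
  proof -
    have "(- 1 / 2 :: real) \<noteq> - real k" for k
    proof
      assume "- 1 / 2 = - real k"
      hence "real (2 * k) = real 1" by simp
      hence "2 * k = 1" by (simp only: of_nat_eq_iff)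
      thus False by presburger
    qed
    from hypergeo_eq_conv_sum[of m "- 1 / 2" "[3 / 2, real n / 2, real n + 1 / 2, 1 - real m]" v
        "[(real n + 3) / 2, 5 / 2 - real m, real n]", OF _ this] show ?thesis
      unfolding D_def B_def v(3,4) v(2) by (simp add: m_def mult_ac) (simp add: v(5))
  qed
  have nz: "N > 0" "Gamma (real n) > 0" "Gamma (real h) > 0" "Gamma (real (2 * h)) > 0" "Gamma (real (Suc h)) > 0"
    "X > 0" "Y > 0" "Gamma (real h + 2) > 0" "Gamma (real h + 1 / 2) > 0"
    unfolding N_def X_def Y_def using h v(1)
    by (auto intro!: pochhammer_pos divide_pos_pos Gamma_real_pos simp: n_def)
  have R: "res_seq v (- 1 / 2) m = N / fact i * (X / Y) * D"
  proof -
    have "v + - 1 / 2 = real h" "1 + v - - 1 / 2 = v + 3 / 2" by (simp_all add: v_def)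
    thus ?thesis unfolding D_def N_def m_def X_def Y_def by (simp only: res_seq.simps res_weight_def v(2))
  qed
  have "real n \<notin> \<int>\<^sub>\<le>\<^sub>0" by (auto simp: n_def elim!: nonpos_Ints_cases)
  hence G1: "Gamma (real m + real n - 1) = Gamma (real n) * N"
    using pochhammer_Gamma[of "real n" i] nz(2) by (simp add: N_def m_def add.commute field_simps)
  have h_pos: "real h > 0" using h by simp
  have G2: "Gamma (real m - 3 / 2) = B * fact i * Gamma (- 1 / 2)"
  proof -
    have "pochhammer (- 1 / 2) i = Gamma (- 1 / 2 + real i) / Gamma (- 1 / 2)" "Gamma (- 1 / 2 :: real) \<noteq> 0"
      using minus_half_not_nonpos_Ints by (simp_all only: pochhammer_Gamma Gamma_eq_zero_iff not_False_eq_True)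
    moreover have "real m - 3 / 2 = - 1 / 2 + real i" by (simp add: m_def)
    ultimately show ?thesis by (simp add: B_def binom_coeff_def)
  qed
  have G3: "Gamma (real m) = fact i"
    unfolding m_def by (subst Gamma_real_nat) auto
  have G4: "(real n + 1) / 2 = real (Suc h)" "real n - 1 = real (2 * h)" "(real n + 3) / 2 = real h + 2"
     "real n / 2 = real h + 1 / 2" "real n + 1 / 2 = real (2 * h + 1) + 1 / 2" "real n - 3 / 2 = real (2 * h - 1) + 1 / 2"
    using h by (simp_all add: n_def field_simps of_nat_diff)
  have "v + 3 / 2 = real h + 2" by (simp add: v_def)
  moreover have "real h + 2 \<notin> \<int>\<^sub>\<le>\<^sub>0" using h_pos by (auto elim!: nonpos_Ints_cases)
  moreover have "real m + real n / 2 + 1 / 2 = real h + 2 + real i" by (simp add: m_def n_def field_simps)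
  ultimately have G5: "Gamma (real m + real n / 2 + 1 / 2) = Gamma (real h + 2) * X"
    using pochhammer_Gamma[of "real h + 2" i] Gamma_neq_0[of "real h + 2"] by (simp add: X_def)
  have "real h \<notin> \<int>\<^sub>\<le>\<^sub>0" using h_pos by (auto elim!: nonpos_Ints_cases)
  moreover have "real m + real n / 2 - 3 / 2 = real h + real i" by (simp add: m_def n_def field_simps)
  ultimately have G6: "Gamma (real m + real n / 2 - 3 / 2) = Gamma (real h) * Y"
    using pochhammer_Gamma[of "real h" i] Gamma_neq_0[of "real h"] h_pos by (simp add: Y_def)
  have "sin (pi * (real h + 1 / 2)) = e"
    unfolding e_def by (simp add: distrib_left sin_add mult.commute)
  hence "Gamma (real h + 1 / 2) * Gamma (1 - (real h + 1 / 2)) = pi / e"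
    using Gamma_reflection_real[of "real h + 1 / 2"] by (simp only:)
  hence G7: "Gamma (1 - (real h + 1 / 2)) = pi / (e * Gamma (real h + 1 / 2))"
    using nz(9) by (metis divide_divide_eq_left less_irrefl nonzero_mult_div_cancel_left)
  have "Gamma (1 / 2 + 1 :: real) = 1 / 2 * Gamma (1 / 2)" "Gamma (- 1 / 2 + 1 :: real) = - 1 / 2 * Gamma (- 1 / 2)"
    by (intro Gamma_plus1 minus_half_not_nonpos_Ints; auto elim!: nonpos_Ints_cases)+
  hence "Gamma (3 / 2 :: real) = sqrt pi / 2" "Gamma (- 1 / 2 :: real) = - 2 * sqrt pi"
    by (simp_all add: Gamma_one_half_real)
  \<comment> \<open>Gamma(-1/2) enters through Gamma(m - 3/2); the product cancels the pi of the
    reflection formula and supplies a minus sign.\<close>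
  hence G8: "Gamma (3 / 2) * Gamma (- 1 / 2) = - pi" by (simp only:) simp
  have e1: "(-1) ^ ((n - 3) div 2) = - e"
  proof -
    obtain g where "h = Suc g" using h by (cases h) auto
    thus ?thesis by (simp add: n_def e_def)
  qed
  have e: "e * e = 1" unfolding e_def by (simp flip: power_mult_distrib)
  have gen: "- (V\<^sup>2 * W * W' / (gh * K * gh1)) * (N / f * (X / Y) * (B * hyp)) =
      - e * (- (g32 * (gn * N) * V * W * W' * (g2 * X) * (B * f * gm)
          / (K * f\<^sup>2 * (gh * Y) * gh1 * g2 * (pi / (e * V)) * gn)) * hyp)"
    if "f > 0" "gn > 0" "V > 0" "g2 > 0" "Y > 0" and g: "g32 * gm = - pi"
    for V W W' gh K gh1 f hyp gn N B X Y g32 gm g2 :: real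
  proof -
    have "e \<noteq> 0" using e by auto
    have "- e * (- (g32 * (gn * N) * V * W * W' * (g2 * X) * (B * f * gm)
          / (K * f\<^sup>2 * (gh * Y) * gh1 * g2 * (pi / (e * V)) * gn)) * hyp) =
        (e * e) * (g32 * gm) / pi * (V\<^sup>2 * W * W' / (gh * K * gh1)) * (N / f * (X / Y) * (B * hyp))"
      using that(1-5) \<open>e \<noteq> 0\<close> by (simp add: divide_simps power2_eq_square)
    also have "\<dots> = - (V\<^sup>2 * W * W' / (gh * K * gh1)) * (N / f * (X / Y) * (B * hyp))"
      unfolding e g by simp
    finally show ?thesis ..
  qed
  show ?thesis
    unfolding R D G1 G2 G3 G5 G6 e1 unfolding G4 G7
    by (rule gen) (use nz G8 in auto)
qed

section \<open>Limits of the continuation and the Wallach set\<close>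

lemma I_mero_limit:
  fixes h :: nat and y :: real
  defines "n \<equiv> 2 * h + 1" and "v \<equiv> real h + 1 / 2"
  assumes h: "h > 0" and y: "y < v + 1" "v + y > 0" "y - real n + real h + 3 / 2 + real i0 = 0" "i0 < 2 * h"
    and frac: "\<And>j::int. y \<noteq> of_int j"
    and r: "2 * (2 * real h)\<^sup>2 * (pochhammer (y - real n + 1) (4 * h) / ((-1) ^ i0 * fact i0 * fact (2 * h - Suc i0)))
      * Z_fun h y = r"
  shows "((\<lambda>s. (s - of_real (y - real n)) * I_mero n m s) \<longlongrightarrow> of_real (r * res_seq v y m)) (at (of_real (y - real n)))"
proof -
  define x where "x = y - real n"
  have xy: "x + real (2 * h + 1) = y" by (simp add: x_def n_def)
  have v: "v = real (2 * h + 1) / 2" by (simp add: v_def field_simps)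
  have "((\<lambda>s. (s - of_real x) * I_cont h 1 s) \<longlongrightarrow> of_real r) (at (of_real x))"
    using I_cont_1_limit[of x h i0, unfolded xy, OF y(3)[folded x_def] y(4) frac]
    unfolding r[folded x_def] .
  hence "((\<lambda>s. (s - of_real x) * I_cont h m s) \<longlongrightarrow> of_real (r * res_seq v y m)) (at (of_real x))"
    using I_cont_limit[of x h r m] y(1,2) unfolding xy v[symmetric] by simp
  moreover have "\<forall>\<^sub>F s in at (of_real x). (s - of_real x) * I_cont h m s = (s - of_real x) * I_mero n m s"
    using I_mero_eq_I_cont[OF h, where z = "of_real x" and m = m] unfolding n_def by eventually_elim simp
  ultimately show ?thesis
    unfolding x_def[symmetric] by (rule Lim_transform_eventually)
qed

text \<open>The common negative factor makes all coefficients nonpositive, and m = 1 already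
  provides the pole.\<close>

lemma discrete_Wallach_set_memI:
  fixes y r :: real
  assumes lim: "\<And>m. ((\<lambda>s. (s - z) * I_mero n m s) \<longlongrightarrow> of_real (r * c m)) (at z)"
    and mero: "\<And>m. I_mero n m meromorphic_on UNIV"
    and c: "\<And>m. c m \<ge> 0" "c 1 > 0" and r: "r < 0"
  shows "z \<in> discrete_Wallach_set n 1"
proof -
  have mero': "I_mero n m meromorphic_on {z}" for m
    by (rule meromorphic_on_subset[OF mero]) auto
  have "complex_of_real (r * c 1) \<noteq> 0"
    using c(2) r by simp
  hence "is_pole (I_mero n 1) z"
    by (rule is_pole_simple_pole[OF mero' lim])
  moreover have "I_coeff n 1 m z \<in> \<real>\<^sub>\<le>\<^sub>0" for m
  proof -
    have "I_coeff n 1 m z = of_real (r * c m)"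
      unfolding I_coeff_def using laurent_expansion_simple_pole[OF mero' lim, of m] by simp
    moreover have "r * c m \<le> 0"
      using c(1)[of m] r by (simp add: mult_nonpos_nonneg)
    ultimately show ?thesis
      by (simp only: nonpos_Reals_of_real_iff)
  qed
  ultimately show ?thesis
    unfolding discrete_Wallach_set_def by blast
qed

theorem theorem4p4:
  fixes n :: nat
  assumes "n \<ge> 3" and "odd n"
  shows "(\<forall>m::nat. m \<ge> 1 \<longrightarrow>
      ((\<lambda>s. (s + of_nat n - 1 / 2) * I_mero n m s) \<longlongrightarrow>
        complex_of_real
         (- (Gamma (real m + real n - 1) * Gamma (real m - 1 / 2) * (Gamma (real n / 2))\<^sup>2
               * (Gamma (real n - 1 / 2))\<^sup>2
             / (Gamma (1 / 2) * (Gamma (real m))\<^sup>2 * Gamma ((real n - 1) / 2) * Gamma (real n)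
               * (Gamma (real n - 1))\<^sup>2 * Gamma ((real n + 1) / 2)))
          * hypergeo [1 / 2, real n / 2, real n - 1 / 2, 1 - real m]
                     [(real n + 1) / 2, real n, 3 / 2 - real m] 1))
        (at (- of_nat n + 1 / 2)))
    \<and> (\<forall>m::nat. m \<ge> 1 \<longrightarrow>
      ((\<lambda>s. (s + of_nat n + 1 / 2) * I_mero n m s) \<longlongrightarrow>
        complex_of_real
         ((-1) ^ ((n - 3) div 2) *
          (- (Gamma (3 / 2) * Gamma (real m + real n - 1) * Gamma (real n / 2)
               * Gamma (real n - 3 / 2) * Gamma (real n + 1 / 2)
               * Gamma (real m + real n / 2 + 1 / 2) * Gamma (real m - 3 / 2)
             / ((Gamma (real n - 1))\<^sup>2 * (Gamma (real m))\<^sup>2 * Gamma (real m + real n / 2 - 3 / 2)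
               * Gamma ((real n + 1) / 2) * Gamma ((real n + 3) / 2) * Gamma (1 - real n / 2)
               * Gamma (real n)))
          * hypergeo [3 / 2, real n / 2, real n + 1 / 2, 1 - real m]
                     [(real n + 3) / 2, 5 / 2 - real m, real n] 1)))
        (at (- of_nat n - 1 / 2)))
    \<and> - of_nat n - 1 / 2 \<in> discrete_Wallach_set n 1
    \<and> - of_nat n + 1 / 2 \<in> discrete_Wallach_set n 1"
proof -
  define h where "h = n div 2"
  have n: "n = 2 * h + 1" and h: "h > 0"
    using assms by (auto simp: h_def elim!: oddE)
  define v where "v = real h + 1 / 2"
  have hr: "real h \<ge> 1" using h by simp
  have frac1: "(1 / 2 :: real) \<noteq> of_int j" and frac2: "(- 1 / 2 :: real) \<noteq> of_int j" for j
    using half_minus_int_ne[of 1 j] half_minus_int_ne[of 0 j] by auto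
  define z1 z2 where "z1 = - complex_of_nat n + 1 / 2" and "z2 = - complex_of_nat n - 1 / 2"
  have z1: "z1 = of_real (1 / 2 - real n)" and z2: "z2 = of_real (- 1 / 2 - real n)"
    by (simp_all add: z1_def z2_def)
  define r1 where "r1 = - ((Gamma (real h + 1 / 2))\<^sup>2 * (Gamma (real (2 * h) + 1 / 2))\<^sup>2 /
        (Gamma (real h) * (Gamma (real (2 * h)))\<^sup>2 * Gamma (real (Suc h))))"
  define r2 where "r2 = - ((Gamma (real h + 1 / 2))\<^sup>2 * Gamma (real (2 * h - 1) + 1 / 2) * Gamma (real (2 * h + 1) + 1 / 2) /
        (Gamma (real h) * (Gamma (real (2 * h)))\<^sup>2 * Gamma (real (Suc h))))"
  have r: "r1 < 0" "r2 < 0"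
    unfolding r1_def r2_def using h
    by (intro neg_less_0_iff_less[THEN iffD2] divide_pos_pos mult_pos_pos zero_less_power Gamma_real_pos; simp)+
  have lim1: "((\<lambda>s. (s - z1) * I_mero n m s) \<longlongrightarrow> of_real (r1 * res_seq v (1 / 2) m)) (at z1)" for m
    unfolding z1 n v_def
  \<comment> \<open>At s = 1/2 - n the vanishing factor s + h + 3/2 + i0 is the one with i0 = h -
    1.\<close>
  proof (rule I_mero_limit[OF h, where ?i0.0 = "h - 1"])
    have "1 / 2 - real (2 * h + 1) + 1 = 1 / 2 - 2 * real h" "2 * h - Suc (h - 1) = h"
      using h by (simp_all add: of_nat_diff)
    thus "2 * (2 * real h)\<^sup>2 * (pochhammer (1 / 2 - real (2 * h + 1) + 1) (4 * h) /
        ((-1) ^ (h - 1) * fact (h - 1) * fact (2 * h - Suc (h - 1)))) * Z_fun h (1 / 2) = r1"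
      unfolding r1_def Z_fun_one_half res_1_one_half[OF h, symmetric] by (simp only:)
  qed (use h hr frac1 in \<open>auto simp: of_nat_diff\<close>)
  have lim2: "((\<lambda>s. (s - z2) * I_mero n m s) \<longlongrightarrow> of_real (r2 * res_seq v (- 1 / 2) m)) (at z2)" for m
    unfolding z2 n v_def
  \<comment> \<open>One unit further left, at s = -1/2 - n, the next factor vanishes.\<close>
  proof (rule I_mero_limit[OF h, where ?i0.0 = h])
    have "- 1 / 2 - real (2 * h + 1) + 1 = - 1 / 2 - 2 * real h" "2 * h - Suc h = h - 1"
      using h by simp_all
    thus "2 * (2 * real h)\<^sup>2 * (pochhammer (- 1 / 2 - real (2 * h + 1) + 1) (4 * h) /
        ((-1) ^ h * fact h * fact (2 * h - Suc h))) * Z_fun h (- 1 / 2) = r2"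
      unfolding r2_def Z_fun_minus_one_half[OF h] res_1_minus_one_half[OF h, symmetric] by (simp only:)
  qed (use h hr frac2 in \<open>auto simp: of_nat_diff\<close>)
  have v: "v > 0" "v \<ge> 1" using hr by (simp_all add: v_def)
  have "z1 \<in> discrete_Wallach_set n 1"
  proof (rule discrete_Wallach_set_memI[OF lim1])
    show "0 \<le> res_seq v (1 / 2) m" for m
      using v by (intro res_seq_nonneg conv_sum_one_half_nonneg) auto
  qed (use I_mero_meromorphic[OF h] r in \<open>auto simp: n res_weight_def\<close>)
  moreover have "z2 \<in> discrete_Wallach_set n 1"
  proof (rule discrete_Wallach_set_memI[OF lim2])
    show "0 \<le> res_seq v (- 1 / 2) m" for m
      using v by (intro res_seq_nonneg conv_sum_minus_one_half_nonneg) auto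
  qed (use I_mero_meromorphic[OF h] r in \<open>auto simp: n res_weight_def\<close>)
  moreover have s: "(s + of_nat n - 1 / 2) = s - z1" "(s + of_nat n + 1 / 2) = s - z2" for s
    by (simp_all add: z1_def z2_def)
  ultimately show ?thesis
    unfolding z1_def[symmetric] z2_def[symmetric] s
  proof (intro conjI allI impI)
    fix m :: nat assume "m \<ge> 1"
    then obtain i where m: "m = Suc i" by (cases m) auto
    show "((\<lambda>s. (s - z1) * I_mero n m s) \<longlongrightarrow>
        complex_of_real
         (- (Gamma (real m + real n - 1) * Gamma (real m - 1 / 2) * (Gamma (real n / 2))\<^sup>2
               * (Gamma (real n - 1 / 2))\<^sup>2
             / (Gamma (1 / 2) * (Gamma (real m))\<^sup>2 * Gamma ((real n - 1) / 2) * Gamma (real n)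
               * (Gamma (real n - 1))\<^sup>2 * Gamma ((real n + 1) / 2)))
          * hypergeo [1 / 2, real n / 2, real n - 1 / 2, 1 - real m]
                     [(real n + 1) / 2, real n, 3 / 2 - real m] 1)) (at z1)"
      using lim1[of m] closed_form_one_half[OF h, of i] unfolding r1_def v_def m n by (simp only:)
    show "((\<lambda>s. (s - z2) * I_mero n m s) \<longlongrightarrow>
        complex_of_real
         ((-1) ^ ((n - 3) div 2) *
          (- (Gamma (3 / 2) * Gamma (real m + real n - 1) * Gamma (real n / 2)
               * Gamma (real n - 3 / 2) * Gamma (real n + 1 / 2)
               * Gamma (real m + real n / 2 + 1 / 2) * Gamma (real m - 3 / 2)
             / ((Gamma (real n - 1))\<^sup>2 * (Gamma (real m))\<^sup>2 * Gamma (real m + real n / 2 - 3 / 2)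
               * Gamma ((real n + 1) / 2) * Gamma ((real n + 3) / 2) * Gamma (1 - real n / 2)
               * Gamma (real n)))
          * hypergeo [3 / 2, real n / 2, real n + 1 / 2, 1 - real m]
                     [(real n + 3) / 2, 5 / 2 - real m, real n] 1))) (at z2)"
      using lim2[of m] closed_form_minus_one_half[OF h, of i] unfolding r2_def v_def m n by (simp only:)
  qed
qed

end
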